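(* Let $X$ be a complex Banach space. Then $X$ has the metric approximation property if and only if $\mathcal G_0(B_X)$ has the metric approximation property.
   Context: A Banach space $E$ has the metric approximation property (MAP) if the identity of $E$ can be approximated, uniformly on compact sets (equivalently, pointwise), by finite-rank operators on $E$ of norm at most $1$. $B_X$ is the open unit ball of $X$. $\mathcal HL_0(B_X)$ is the Banach space of holomorphic Lipschitz functions $f:B_X\to\mathbb C$ with $f(0)=0$, normed by the Lipschitz constant $L(f)$. With $\tau_0$ the compact-open topology (uniform convergence on compact subsets of $B_X$), $\mathcal G_0(B_X)=\{\varphi\in\mathcal HL_0(B_X)^*: \varphi \text{ restricted to } \{f:L(f)\le1\}\text{ is }\tau_0\text{-continuous}\}$, with the norm of $\mathcal HL_0(B_X)^*$. *)

theory Defs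
  imports "HOL-Analysis.Analysis"
begin

section \<open>Complex normed spaces\<close>

class complex_normed_vector = real_normed_vector +
  fixes scaleC :: "complex \<Rightarrow> 'a \<Rightarrow> 'a" (infixr \<open>*\<^sub>C\<close> 75)
  assumes scaleC_add_right: "c *\<^sub>C (x + y) = c *\<^sub>C x + c *\<^sub>C y"
    and scaleC_add_left: "(c + d) *\<^sub>C x = c *\<^sub>C x + d *\<^sub>C x"
    and scaleC_scaleC: "c *\<^sub>C d *\<^sub>C x = (c * d) *\<^sub>C x"
    and scaleC_of_real: "complex_of_real r *\<^sub>C x = r *\<^sub>R x"
    and norm_scaleC: "norm (c *\<^sub>C x) = cmod c * norm x"

class complex_banach = complex_normed_vector + banach

lemma scaleC_vector_space: "vector_space (scaleC :: complex \<Rightarrow> 'a::complex_normed_vector \<Rightarrow> 'a)"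
  using scaleC_of_real[of 1]
  by unfold_locales (auto simp: scaleC_add_right scaleC_add_left scaleC_scaleC)

lemma scaleC_bounded_linear: "bounded_linear ((*\<^sub>C) c :: 'a::complex_normed_vector \<Rightarrow> 'a)"
proof (rule bounded_linear_intro)
  fix r :: real and x :: 'a
  show "c *\<^sub>C r *\<^sub>R x = r *\<^sub>R c *\<^sub>C x"
    by (metis mult.commute scaleC_of_real scaleC_scaleC)
  show "norm (c *\<^sub>C x) \<le> norm x * cmod c"
    by (simp add: norm_scaleC)
qed (simp add: scaleC_add_right)

instantiation complex :: complex_normed_vector
begin

definition scaleC_complex :: "complex \<Rightarrow> complex \<Rightarrow> complex"
  where [simp]: "scaleC_complex c z = c * z"

instance
  by standard (auto simp: algebra_simps norm_mult scaleR_conv_of_real)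

end

instance complex :: complex_banach ..

instantiation blinfun :: (real_normed_vector, complex_normed_vector) complex_normed_vector
begin

lift_definition scaleC_blinfun :: "complex \<Rightarrow> 'a \<Rightarrow>\<^sub>L 'b \<Rightarrow> 'a \<Rightarrow>\<^sub>L 'b"
  is "\<lambda>c f x. c *\<^sub>C f x"
  by (rule bounded_linear_compose[OF scaleC_bounded_linear])

lemma norm_scaleC_blinfun_le: "norm (c *\<^sub>C f) \<le> cmod c * norm f" for f :: "'a \<Rightarrow>\<^sub>L 'b"
proof (rule norm_blinfun_bound)
  show "norm (blinfun_apply (c *\<^sub>C f) x) \<le> cmod c * norm f * norm x" for x
    using mult_left_mono[OF norm_blinfun[of f x], of "cmod c"]
    by (simp add: scaleC_blinfun.rep_eq norm_scaleC mult.assoc)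
qed simp

instance
proof
  fix c d :: complex and f g :: "'a \<Rightarrow>\<^sub>L 'b" and r :: real
  show *: "c *\<^sub>C d *\<^sub>C f = (c * d) *\<^sub>C f" for c d and f :: "'a \<Rightarrow>\<^sub>L 'b"
    by transfer (simp add: scaleC_scaleC)
  show r: "complex_of_real r *\<^sub>C f = r *\<^sub>R f" for r and f :: "'a \<Rightarrow>\<^sub>L 'b"
    by transfer (simp add: scaleC_of_real)
  show "c *\<^sub>C (f + g) = c *\<^sub>C f + c *\<^sub>C g"
    by transfer (simp add: scaleC_add_right)
  show "(c + d) *\<^sub>C f = c *\<^sub>C f + d *\<^sub>C f"
    by transfer (simp add: scaleC_add_left)
  show "norm (c *\<^sub>C f) = cmod c * norm f"
  proof (cases "c = 0")
    case True
    then show ?thesis using r[of 0 f] by simp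
  next
    case False
    have "norm f = norm (inverse c *\<^sub>C c *\<^sub>C f)"
      using False r[of 1 f] by (simp add: *)
    also have "\<dots> \<le> inverse (cmod c) * norm (c *\<^sub>C f)"
      using norm_scaleC_blinfun_le[of "inverse c" "c *\<^sub>C f"] by (simp add: norm_inverse)
    finally have "cmod c * norm f \<le> norm (c *\<^sub>C f)"
      using False by (simp add: field_simps)
    then show ?thesis using norm_scaleC_blinfun_le[of c f] by simp
  qed
qed

end

section \<open>The metric approximation property\<close>

definition bounded_clinear :: "('a::complex_normed_vector \<Rightarrow> 'b::complex_normed_vector) \<Rightarrow> bool"
  where "bounded_clinear T \<longleftrightarrow> bounded_linear T \<and> (\<forall>c x. T (c *\<^sub>C x) = c *\<^sub>C T x)"

definition finite_rank :: "('a \<Rightarrow> 'b::complex_normed_vector) \<Rightarrow> bool"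
  where "finite_rank T \<longleftrightarrow> (\<exists>B. finite B \<and> range T \<subseteq> module.span scaleC B)"

definition metric_approximation_property :: "'a::complex_banach itself \<Rightarrow> bool"
  where "metric_approximation_property _ \<longleftrightarrow>
    (\<forall>K :: 'a set. \<forall>\<epsilon>>0. compact K \<longrightarrow>
      (\<exists>T :: 'a \<Rightarrow> 'a. bounded_clinear T \<and> finite_rank T \<and> onorm T \<le> 1 \<and>
        (\<forall>x\<in>K. norm (T x - x) < \<epsilon>)))"

section \<open>Holomorphic Lipschitz functions on the open unit ball\<close>

text \<open>Holomorphic means complex Frechet differentiable at every point.\<close>

definition holomorphic_on_unit_ball :: "('a::complex_normed_vector \<Rightarrow> complex) \<Rightarrow> bool"
  where "holomorphic_on_unit_ball f \<longleftrightarrow>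
    (\<forall>x\<in>ball 0 1. \<exists>A. bounded_clinear A \<and> (f has_derivative A) (at x))"

text \<open>The last conjunct makes a function on the ball and its representative on the whole type
  determine each other.\<close>

typedef (overloaded) 'a hol_lip =
  "{f :: 'a::complex_normed_vector \<Rightarrow> complex.
     holomorphic_on_unit_ball f \<and> (\<exists>C. C-lipschitz_on (ball 0 1) f) \<and> f 0 = 0 \<and>
     (\<forall>x. x \<notin> ball 0 1 \<longrightarrow> f x = 0)}"
  morphisms hl_apply Abs_hol_lip
proof
  show "(\<lambda>_. 0) \<in> {f :: 'a \<Rightarrow> complex.
     holomorphic_on_unit_ball f \<and> (\<exists>C. C-lipschitz_on (ball 0 1) f) \<and> f 0 = 0 \<and>
     (\<forall>x. x \<notin> ball 0 1 \<longrightarrow> f x = 0)}"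
    by (auto simp: holomorphic_on_unit_ball_def bounded_clinear_def
        intro!: exI[of _ "\<lambda>_. 0"] bounded_linear_zero exI[of _ 0] lipschitz_on_constant
          scaleC_of_real[of 0 "0::complex", simplified])
qed

setup_lifting type_definition_hol_lip

definition Lipschitz_constant :: "('a::real_normed_vector \<Rightarrow> complex) \<Rightarrow> real"
  where "Lipschitz_constant f = Inf {C. C-lipschitz_on (ball 0 1) f}"

lemma Lipschitz_constant_nonneg:
  assumes "C-lipschitz_on (ball 0 1) f"
  shows "0 \<le> Lipschitz_constant f"
  unfolding Lipschitz_constant_def
  using assms by (intro cInf_greatest) (auto dest: lipschitz_on_nonneg)

lemma Lipschitz_constant_le:
  assumes "C-lipschitz_on (ball 0 1) f"
  shows "Lipschitz_constant f \<le> C"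
  unfolding Lipschitz_constant_def
  using assms by (intro cInf_lower) (auto intro!: bdd_belowI[of _ 0] dest: lipschitz_on_nonneg)

lemma Lipschitz_constant_lipschitz:
  assumes "C-lipschitz_on (ball 0 1) f"
  shows "(Lipschitz_constant f)-lipschitz_on (ball 0 1) f"
proof (rule lipschitz_onI)
  fix x y :: 'a assume xy: "x \<in> ball 0 1" "y \<in> ball 0 1"
  show "dist (f x) (f y) \<le> Lipschitz_constant f * dist x y"
  proof (cases "x = y")
    case False
    have "dist (f x) (f y) / dist x y \<le> Lipschitz_constant f"
      unfolding Lipschitz_constant_def
      using assms False xy
      by (intro cInf_greatest) (auto simp: divide_le_eq dest: lipschitz_onD)
    then show ?thesis using False by (simp add: divide_le_eq)
  qed simp
qed (rule Lipschitz_constant_nonneg[OF assms])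

instantiation hol_lip :: (complex_normed_vector) complex_normed_vector
begin

lift_definition zero_hol_lip :: "'a hol_lip" is "\<lambda>_. 0"
  by (auto simp: holomorphic_on_unit_ball_def bounded_clinear_def
        intro!: exI[of _ "\<lambda>_. 0"] bounded_linear_zero exI[of _ 0] lipschitz_on_constant)

lift_definition plus_hol_lip :: "'a hol_lip \<Rightarrow> 'a hol_lip \<Rightarrow> 'a hol_lip"
  is "\<lambda>f g x. f x + g x"
proof -
  fix f g :: "'a \<Rightarrow> complex"
  assume f: "holomorphic_on_unit_ball f \<and> (\<exists>C. C-lipschitz_on (ball 0 1) f) \<and> f 0 = 0 \<and>
     (\<forall>x. x \<notin> ball 0 1 \<longrightarrow> f x = 0)"
    and g: "holomorphic_on_unit_ball g \<and> (\<exists>C. C-lipschitz_on (ball 0 1) g) \<and> g 0 = 0 \<and>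
     (\<forall>x. x \<notin> ball 0 1 \<longrightarrow> g x = 0)"
  have "holomorphic_on_unit_ball (\<lambda>x. f x + g x)"
    unfolding holomorphic_on_unit_ball_def
  proof
    fix x :: 'a assume x: "x \<in> ball 0 1"
    obtain A where A: "bounded_clinear A" "(f has_derivative A) (at x)"
      using f x unfolding holomorphic_on_unit_ball_def by blast
    obtain B where B: "bounded_clinear B" "(g has_derivative B) (at x)"
      using g x unfolding holomorphic_on_unit_ball_def by blast
    have "bounded_clinear (\<lambda>h. A h + B h)"
      using A(1) B(1) unfolding bounded_clinear_def
      by (auto intro: bounded_linear_add simp: distrib_left)
    then show "\<exists>A. bounded_clinear A \<and> ((\<lambda>x. f x + g x) has_derivative A) (at x)"
      using has_derivative_add[OF A(2) B(2)] by blast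
  qed
  moreover have "\<exists>C. C-lipschitz_on (ball 0 1) (\<lambda>x. f x + g x)"
    using f g lipschitz_on_add by blast
  ultimately show "holomorphic_on_unit_ball (\<lambda>x. f x + g x) \<and>
      (\<exists>C. C-lipschitz_on (ball 0 1) (\<lambda>x. f x + g x)) \<and> f 0 + g 0 = 0 \<and>
     (\<forall>x. x \<notin> ball 0 1 \<longrightarrow> f x + g x = 0)"
    using f g by simp
qed

lift_definition scaleC_hol_lip :: "complex \<Rightarrow> 'a hol_lip \<Rightarrow> 'a hol_lip"
  is "\<lambda>c f x. c * f x"
proof -
  fix c and f :: "'a \<Rightarrow> complex"
  assume f: "holomorphic_on_unit_ball f \<and> (\<exists>C. C-lipschitz_on (ball 0 1) f) \<and> f 0 = 0 \<and>
     (\<forall>x. x \<notin> ball 0 1 \<longrightarrow> f x = 0)"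
  then obtain C where C: "C-lipschitz_on (ball 0 1) f" by blast
  have "(cmod c * C)-lipschitz_on (ball 0 1) (\<lambda>x. c * f x)"
  proof (rule lipschitz_onI)
    fix x y :: 'a assume "x \<in> ball 0 1" "y \<in> ball 0 1"
    then have "cmod c * dist (f x) (f y) \<le> cmod c * (C * dist x y)"
      by (intro mult_left_mono lipschitz_onD[OF C]) auto
    then show "dist (c * f x) (c * f y) \<le> cmod c * C * dist x y"
      by (simp add: dist_mult_left mult.assoc)
  qed (use lipschitz_on_nonneg[OF C] in auto)
  moreover have "holomorphic_on_unit_ball (\<lambda>x. c * f x)"
    unfolding holomorphic_on_unit_ball_def
  proof
    fix x :: 'a assume "x \<in> ball 0 1"
    then obtain A where A: "bounded_clinear A" "(f has_derivative A) (at x)"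
      using f unfolding holomorphic_on_unit_ball_def by blast
    have "bounded_clinear (\<lambda>h. c * A h)"
      using A(1) unfolding bounded_clinear_def
      by (auto intro: bounded_linear_const_mult)
    moreover have "((\<lambda>x. c * f x) has_derivative (\<lambda>h. c * A h)) (at x)"
      by (rule has_derivative_mult_right[OF A(2)])
    ultimately show "\<exists>A. bounded_clinear A \<and> ((\<lambda>x. c * f x) has_derivative A) (at x)"
      by blast
  qed
  ultimately show "holomorphic_on_unit_ball (\<lambda>x. c * f x) \<and>
      (\<exists>C. C-lipschitz_on (ball 0 1) (\<lambda>x. c * f x)) \<and> c * f 0 = 0 \<and>
     (\<forall>x. x \<notin> ball 0 1 \<longrightarrow> c * f x = 0)"
    using f by auto
qed

lift_definition norm_hol_lip :: "'a hol_lip \<Rightarrow> real" is Lipschitz_constant .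

definition scaleR_hol_lip :: "real \<Rightarrow> 'a hol_lip \<Rightarrow> 'a hol_lip"
  where "scaleR_hol_lip r f = complex_of_real r *\<^sub>C f"

definition uminus_hol_lip :: "'a hol_lip \<Rightarrow> 'a hol_lip"
  where "uminus_hol_lip f = (- 1) *\<^sub>C f"

definition minus_hol_lip :: "'a hol_lip \<Rightarrow> 'a hol_lip \<Rightarrow> 'a hol_lip"
  where "minus_hol_lip f g = f + - g"

definition dist_hol_lip :: "'a hol_lip \<Rightarrow> 'a hol_lip \<Rightarrow> real"
  where "dist_hol_lip f g = norm (f - g)"

definition sgn_hol_lip :: "'a hol_lip \<Rightarrow> 'a hol_lip"
  where "sgn_hol_lip f = inverse (norm f) *\<^sub>R f"

definition uniformity_hol_lip :: "('a hol_lip \<times> 'a hol_lip) filter"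
  where "uniformity_hol_lip = (INF e\<in>{0<..}. principal {(f, g). dist f g < e})"

definition open_hol_lip :: "'a hol_lip set \<Rightarrow> bool"
  where "open_hol_lip U \<longleftrightarrow> (\<forall>f\<in>U. eventually (\<lambda>(f', g). f' = f \<longrightarrow> g \<in> U) uniformity)"

lemma hl_lipschitz: "(norm f)-lipschitz_on (ball 0 1) (hl_apply f)"
  by transfer (blast intro: Lipschitz_constant_lipschitz)

lemma norm_hl_le: "C-lipschitz_on (ball 0 1) (hl_apply f) \<Longrightarrow> norm f \<le> C"
  by transfer (rule Lipschitz_constant_le)

lemma norm_hl_nonneg: "0 \<le> norm (f :: 'a hol_lip)"
  using lipschitz_on_nonneg[OF hl_lipschitz] .

lemma norm_scaleC_hol_lip_le: "norm (c *\<^sub>C f) \<le> cmod c * norm f" for f :: "'a hol_lip"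
proof (rule norm_hl_le, rule lipschitz_onI)
  fix x y :: 'a assume "x \<in> ball 0 1" "y \<in> ball 0 1"
  then have "cmod c * dist (hl_apply f x) (hl_apply f y) \<le> cmod c * (norm f * dist x y)"
    by (intro mult_left_mono lipschitz_onD[OF hl_lipschitz]) auto
  then show "dist (hl_apply (c *\<^sub>C f) x) (hl_apply (c *\<^sub>C f) y) \<le> cmod c * norm f * dist x y"
    by (simp add: scaleC_hol_lip.rep_eq dist_mult_left mult.assoc)
qed (simp add: norm_hl_nonneg)

instance
proof
  fix f g h :: "'a hol_lip" and c d :: complex and a b :: real
  show scaleC_scaleC: "c *\<^sub>C d *\<^sub>C f = (c * d) *\<^sub>C f" for c d and f :: "'a hol_lip"
    by transfer (simp add: mult.assoc)
  have one: "1 *\<^sub>C f = f" for f :: "'a hol_lip"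
    by transfer simp
  have zero: "0 *\<^sub>C f = 0" for f :: "'a hol_lip"
    by transfer simp
  have zero0: "norm (0 :: 'a hol_lip) = 0"
    using norm_hl_le[of 0 "0 :: 'a hol_lip"] norm_hl_nonneg[of "0 :: 'a hol_lip"]
    by (simp add: zero_hol_lip.rep_eq lipschitz_on_constant)
  show "f + g + h = f + (g + h)" by transfer (simp add: add.assoc)
  show "f + g = g + f" by transfer (simp add: add.commute)
  show "0 + f = f" by transfer simp
  show "- f + f = 0" unfolding uminus_hol_lip_def by transfer simp
  show "f - g = f + - g" by (rule minus_hol_lip_def)
  show addr: "c *\<^sub>C (f + g) = c *\<^sub>C f + c *\<^sub>C g" for c
    by transfer (simp add: distrib_left)
  show addl: "(c + d) *\<^sub>C f = c *\<^sub>C f + d *\<^sub>C f" for c d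
    by transfer (simp add: distrib_right)
  show "complex_of_real a *\<^sub>C f = a *\<^sub>R f" by (simp add: scaleR_hol_lip_def)
  show "a *\<^sub>R (f + g) = a *\<^sub>R f + a *\<^sub>R g" by (simp add: scaleR_hol_lip_def addr)
  show "(a + b) *\<^sub>R f = a *\<^sub>R f + b *\<^sub>R f" by (simp add: scaleR_hol_lip_def addl)
  show "a *\<^sub>R b *\<^sub>R f = (a * b) *\<^sub>R f" by (simp add: scaleR_hol_lip_def scaleC_scaleC)
  show "1 *\<^sub>R f = f" by (simp add: scaleR_hol_lip_def one)
  show norm_scaleC: "norm (c *\<^sub>C f) = cmod c * norm f" for c
  proof (cases "c = 0")
    case True
    then show ?thesis by (simp add: zero zero0)
  next
    case False
    have "norm f = norm (inverse c *\<^sub>C c *\<^sub>C f)"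
      using False by (simp add: scaleC_scaleC one)
    also have "\<dots> \<le> inverse (cmod c) * norm (c *\<^sub>C f)"
      using norm_scaleC_hol_lip_le[of "inverse c" "c *\<^sub>C f"] by (simp add: norm_inverse)
    finally have "cmod c * norm f \<le> norm (c *\<^sub>C f)"
      using False by (simp add: field_simps)
    then show ?thesis using norm_scaleC_hol_lip_le[of c f] by simp
  qed
  show "norm (a *\<^sub>R f) = \<bar>a\<bar> * norm f" by (simp add: scaleR_hol_lip_def norm_scaleC)
  show "norm (f + g) \<le> norm f + norm g"
    by (rule norm_hl_le)
      (simp add: plus_hol_lip.rep_eq lipschitz_on_add[OF hl_lipschitz hl_lipschitz])
  show "norm f = 0 \<longleftrightarrow> f = 0"
  proof
    assume 0: "norm f = 0"
    have "hl_apply f x = 0" for x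
    proof (cases "x \<in> ball 0 1")
      case True
      then have "dist (hl_apply f x) (hl_apply f 0) \<le> 0"
        using lipschitz_onD[OF hl_lipschitz[of f] True, of 0] 0 by simp
      then show ?thesis using hl_apply[of f] by simp
    next
      case False
      then show ?thesis using hl_apply[of f] by blast
    qed
    then show "f = 0" by (simp add: hl_apply_inject[symmetric] zero_hol_lip.rep_eq fun_eq_iff)
  qed (simp add: zero0)
qed (rule dist_hol_lip_def sgn_hol_lip_def uniformity_hol_lip_def
      open_hol_lip_def[unfolded case_prod_beta'] open_hol_lip_def)+

end

section \<open>The predual of the holomorphic Lipschitz functions\<close>

text \<open>The compact-open topology. The supremum of \<open>|g - f|\<close> over a compact \<open>K\<close> is attained, so the
  generating sets are the open balls of the seminorms of uniform convergence on \<open>K\<close>.\<close>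

definition tau0 :: "'a::complex_normed_vector hol_lip topology"
  where "tau0 = topology_generated_by
    {{g. \<forall>x\<in>K. cmod (hl_apply g x - hl_apply f x) < \<epsilon>} | f K \<epsilon>.
      compact K \<and> K \<subseteq> ball 0 1 \<and> 0 < \<epsilon>}"

text \<open>A functional lies in the (complex) dual of \<open>'a hol_lip\<close> iff it is bounded and
  complex-linear; its dual norm is the operator norm of \<open>blinfun\<close>.\<close>

definition G0_set :: "('a::complex_normed_vector hol_lip \<Rightarrow>\<^sub>L complex) set"
  where "G0_set = {\<phi>. bounded_clinear (blinfun_apply \<phi>) \<and>
    continuous_map (subtopology tau0 {f. norm f \<le> 1}) euclidean (blinfun_apply \<phi>)}"

lemma G0_zero: "0 \<in> G0_set"
  by (simp add: G0_set_def bounded_clinear_def blinfun.bounded_linear_right zero_blinfun.rep_eq)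

lemma G0_add: "\<phi> \<in> G0_set \<Longrightarrow> \<psi> \<in> G0_set \<Longrightarrow> \<phi> + \<psi> \<in> G0_set"
  by (auto simp: G0_set_def bounded_clinear_def blinfun.bounded_linear_right plus_blinfun.rep_eq
      distrib_left intro!: continuous_map_add bounded_linear_add)

lemma G0_scaleC:
  assumes "\<phi> \<in> G0_set" shows "c *\<^sub>C \<phi> \<in> G0_set"
proof -
  have "continuous_map (subtopology tau0 {f. norm f \<le> 1}) euclidean ((*) c \<circ> blinfun_apply \<phi>)"
    using assms unfolding G0_set_def
    by (auto intro!: continuous_map_compose[where X' = euclidean] continuous_intros)
  then show ?thesis
    using assms
    by (auto simp: G0_set_def bounded_clinear_def scaleC_blinfun.rep_eq o_def
        intro!: bounded_linear_const_mult)
qed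

lemma G0_closed: "closed (G0_set :: ('a::complex_normed_vector hol_lip \<Rightarrow>\<^sub>L complex) set)"
  unfolding closed_sequential_limits
proof (intro allI impI, elim conjE)
  fix \<Phi> :: "nat \<Rightarrow> 'a hol_lip \<Rightarrow>\<^sub>L complex" and \<phi>
  assume \<Phi>: "\<forall>n. \<Phi> n \<in> G0_set" and lim: "\<Phi> \<longlonglongrightarrow> \<phi>"
  have pt: "(\<lambda>n. \<Phi> n f) \<longlonglongrightarrow> \<phi> f" for f
    using lim by (intro tendsto_intros)
  have "\<phi> (c *\<^sub>C f) = c *\<^sub>C \<phi> f" for c f
  proof (rule LIMSEQ_unique[OF pt])
    have "(\<lambda>n. c * \<Phi> n f) \<longlonglongrightarrow> c * \<phi> f"
      by (intro tendsto_intros pt)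
    then show "(\<lambda>n. \<Phi> n (c *\<^sub>C f)) \<longlonglongrightarrow> c *\<^sub>C \<phi> f"
      using \<Phi> by (simp add: G0_set_def bounded_clinear_def)
  qed
  moreover have "continuous_map (subtopology tau0 {f. norm f \<le> 1}) euclidean (blinfun_apply \<phi>)"
  proof -
    let ?X = "subtopology tau0 {f :: 'a hol_lip. norm f \<le> 1}"
    have "continuous_map ?X Met_TC.mtopology (blinfun_apply \<phi>)"
    proof (rule Met_TC.continuous_map_uniform_limit)
      show "\<forall>\<^sub>F n in sequentially. continuous_map ?X Met_TC.mtopology (blinfun_apply (\<Phi> n))"
        using \<Phi> by (simp add: G0_set_def)
      show "\<forall>\<^sub>F n in sequentially. \<forall>f\<in>topspace ?X. \<phi> f \<in> UNIV \<and> dist (\<Phi> n f) (\<phi> f) < \<epsilon>"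
        if "0 < \<epsilon>" for \<epsilon>
        using tendstoD[OF lim that]
      proof eventually_elim
        case (elim n)
        show ?case
        proof (intro ballI conjI UNIV_I)
          fix f assume "f \<in> topspace ?X"
          then have "norm f \<le> 1" by simp
          then have "norm ((\<Phi> n - \<phi>) f) \<le> norm (\<Phi> n - \<phi>)"
            using norm_blinfun[of "\<Phi> n - \<phi>" f] mult_left_le[of "norm f" "norm (\<Phi> n - \<phi>)"]
            by simp
          then show "dist (\<Phi> n f) (\<phi> f) < \<epsilon>"
            using elim by (simp add: dist_norm blinfun.diff_left)
        qed
      qed
    qed simp
    then show ?thesis by simp
  qed
  ultimately show "\<phi> \<in> G0_set"
    by (simp add: G0_set_def bounded_clinear_def blinfun.bounded_linear_right)
qed

typedef (overloaded) 'a G0 = "G0_set :: ('a::complex_normed_vector hol_lip \<Rightarrow>\<^sub>L complex) set"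
  morphisms G0_functional Abs_G0
  using G0_zero by blast

setup_lifting type_definition_G0

instantiation G0 :: (complex_normed_vector) complex_normed_vector
begin

lift_definition zero_G0 :: "'a G0" is 0 by (rule G0_zero)

lift_definition plus_G0 :: "'a G0 \<Rightarrow> 'a G0 \<Rightarrow> 'a G0" is "(+)" by (rule G0_add)

lift_definition scaleC_G0 :: "complex \<Rightarrow> 'a G0 \<Rightarrow> 'a G0" is "(*\<^sub>C)" by (rule G0_scaleC)

lift_definition scaleR_G0 :: "real \<Rightarrow> 'a G0 \<Rightarrow> 'a G0" is "(*\<^sub>R)"
  by (simp add: G0_scaleC scaleC_of_real[symmetric])

lift_definition uminus_G0 :: "'a G0 \<Rightarrow> 'a G0" is uminus
  using G0_scaleC[of _ "complex_of_real (- 1)"] unfolding scaleC_of_real by simp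

lift_definition minus_G0 :: "'a G0 \<Rightarrow> 'a G0 \<Rightarrow> 'a G0" is "(-)"
proof -
  fix \<phi> \<psi> :: "'a hol_lip \<Rightarrow>\<^sub>L complex" assume "\<phi> \<in> G0_set" "\<psi> \<in> G0_set"
  then show "\<phi> - \<psi> \<in> G0_set"
    using G0_add[OF _ G0_scaleC[of \<psi> "complex_of_real (- 1)"], of \<phi>] unfolding scaleC_of_real
    by simp
qed

lift_definition norm_G0 :: "'a G0 \<Rightarrow> real" is norm .

definition dist_G0 :: "'a G0 \<Rightarrow> 'a G0 \<Rightarrow> real"
  where "dist_G0 \<phi> \<psi> = norm (\<phi> - \<psi>)"

definition sgn_G0 :: "'a G0 \<Rightarrow> 'a G0"
  where "sgn_G0 \<phi> = inverse (norm \<phi>) *\<^sub>R \<phi>"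

definition uniformity_G0 :: "('a G0 \<times> 'a G0) filter"
  where "uniformity_G0 = (INF e\<in>{0<..}. principal {(\<phi>, \<psi>). dist \<phi> \<psi> < e})"

definition open_G0 :: "'a G0 set \<Rightarrow> bool"
  where "open_G0 U \<longleftrightarrow> (\<forall>\<phi>\<in>U. eventually (\<lambda>(\<phi>', \<psi>). \<phi>' = \<phi> \<longrightarrow> \<psi> \<in> U) uniformity)"

instance
proof intro_classes
  fix \<phi> \<psi> \<xi> :: "'a G0" and c d :: complex and a b :: real
  show "\<phi> + \<psi> + \<xi> = \<phi> + (\<psi> + \<xi>)" by transfer (simp add: add.assoc)
  show "\<phi> + \<psi> = \<psi> + \<phi>" by transfer (simp add: add.commute)
  show "0 + \<phi> = \<phi>" by transfer simp
  show "- \<phi> + \<phi> = 0" by transfer simp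
  show "\<phi> - \<psi> = \<phi> + - \<psi>" by transfer simp
  show "a *\<^sub>R (\<phi> + \<psi>) = a *\<^sub>R \<phi> + a *\<^sub>R \<psi>" by transfer (simp add: scaleR_add_right)
  show "(a + b) *\<^sub>R \<phi> = a *\<^sub>R \<phi> + b *\<^sub>R \<phi>" by transfer (simp add: scaleR_add_left)
  show "a *\<^sub>R b *\<^sub>R \<phi> = (a * b) *\<^sub>R \<phi>" by transfer simp
  show "1 *\<^sub>R \<phi> = \<phi>" by transfer simp
  show "norm \<phi> = 0 \<longleftrightarrow> \<phi> = 0" by transfer simp
  show "norm (\<phi> + \<psi>) \<le> norm \<phi> + norm \<psi>" by transfer (rule norm_triangle_ineq)
  show "norm (a *\<^sub>R \<phi>) = \<bar>a\<bar> * norm \<phi>" by transfer simp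
  show "c *\<^sub>C (\<phi> + \<psi>) = c *\<^sub>C \<phi> + c *\<^sub>C \<psi>" by transfer (rule scaleC_add_right)
  show "(c + d) *\<^sub>C \<phi> = c *\<^sub>C \<phi> + d *\<^sub>C \<phi>" by transfer (rule scaleC_add_left)
  show "c *\<^sub>C d *\<^sub>C \<phi> = (c * d) *\<^sub>C \<phi>" by transfer (rule scaleC_scaleC)
  show "complex_of_real a *\<^sub>C \<phi> = a *\<^sub>R \<phi>" by transfer (rule scaleC_of_real)
  show "norm (c *\<^sub>C \<phi>) = cmod c * norm \<phi>" by transfer (rule norm_scaleC)
  show "dist \<phi> \<psi> = norm (\<phi> - \<psi>)" by (rule dist_G0_def)
  show "sgn \<phi> = inverse (norm \<phi>) *\<^sub>R \<phi>" by (rule sgn_G0_def)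
  show "(uniformity :: ('a G0 \<times> 'a G0) filter) = (INF e\<in>{0<..}. principal {(x, y). dist x y < e})"
    by (rule uniformity_G0_def)
  show "open U \<longleftrightarrow> (\<forall>x\<in>U. \<forall>\<^sub>F (x', y) in uniformity. x' = x \<longrightarrow> y \<in> U)" for U :: "'a G0 set"
    by (rule open_G0_def)
qed

end

lemma dist_G0_functional: "dist \<phi> \<psi> = dist (G0_functional \<phi>) (G0_functional \<psi>)"
  by (simp add: dist_G0_def norm_G0.rep_eq minus_G0.rep_eq dist_norm)

instance G0 :: (complex_normed_vector) complex_banach
proof
  fix \<Phi> :: "nat \<Rightarrow> 'a G0"
  assume "Cauchy \<Phi>"
  then have "Cauchy (\<lambda>n. G0_functional (\<Phi> n))"
    unfolding Cauchy_def dist_G0_functional .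
  then obtain \<phi> where lim: "(\<lambda>n. G0_functional (\<Phi> n)) \<longlonglongrightarrow> \<phi>"
    unfolding Cauchy_convergent_iff convergent_def by blast
  have "\<phi> \<in> G0_set"
    by (rule closed_sequentially[OF G0_closed _ lim]) (rule G0_functional)
  then have "\<phi> = G0_functional (Abs_G0 \<phi>)"
    by (simp add: Abs_G0_inverse)
  then have "\<Phi> \<longlonglongrightarrow> Abs_G0 \<phi>"
    using lim unfolding lim_sequentially dist_G0_functional by simp
  then show "convergent \<Phi>"
    by (auto simp: convergent_def)
qed

end

theory Submission
  imports Defs "HOL-Complex_Analysis.Cauchy_Integral_Formula"
begin

text \<open>
Write \<open>X\<close> for the Banach space, \<open>G\<close> for the predual of the holomorphic Lipschitz functions on its unit
ball, and \<open>L(f)\<close> for the Lipschitz constant of \<open>f\<close>.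

From \<open>G\<close> to \<open>X\<close>. The space \<open>X\<close> is a contractively complemented subspace of \<open>G\<close>, and the metric
approximation property passes to such subspaces. The embedding sends \<open>x\<close> to the functional
\<open>f \<mapsto> f'(0) x\<close> (\<open>taylor_functional 1\<close>), and the projection sends \<open>\<phi>\<close> to its barycentre, the point of \<open>X\<close> on
which every bounded linear functional takes the value that \<open>\<phi>\<close> assigns to it (\<open>ex_barycentre\<close>).
That this point lies in \<open>X\<close> and not merely in its bidual follows from the density of the
combinations of point evaluations (\<open>G0_approximable_by_evaluations\<close>) and the completeness of \<open>X\<close>;
density and the norm bounds come from the Hahn-Banach theorem.

From \<open>X\<close> to \<open>G\<close>. Let \<open>T\<close> be a contraction of finite rank on \<open>X\<close> that is close to the identity on a compact
set. The composition operator \<open>f \<mapsto> f \<circ> T\<close> is a contraction, but has infinite rank if \<open>T \<noteq> 0\<close>. Let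
\<open>Q f = (\<Sum>k\<le>n. r\<^sup>k P\<^sub>k f) \<circ> T\<close> with \<open>0 < r < 1\<close>, where \<open>P\<^sub>k f\<close> is the \<open>k\<close>-homogeneous part of \<open>f\<close>. Cauchy's
estimates give \<open>L(P\<^sub>k f) \<le> L(f)\<close>, so the sum differs from the dilate \<open>x \<mapsto> f (r x)\<close>, whose Lipschitz constant
is at most \<open>r L(f)\<close>, by a function of Lipschitz constant at most \<open>r\<^sup>n\<^sup>+\<^sup>1 / (1 - r) L(f)\<close>. For large \<open>n\<close> this is
at most \<open>(1 - r) L(f)\<close>, and \<open>Q\<close> is a contraction; if \<open>r\<close> is close to 1, then
\<open>Q f\<close> is close to \<open>f\<close> on the compact set, uniformly for \<open>L(f) \<le> 1\<close>. A homogeneous part is a polynomial on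
every line, so on the finite-dimensional range of \<open>T\<close> it is determined by its values on a finite
grid, and \<open>Q\<close> has finite rank (\<open>Q_star_finite_rank\<close>). It is continuous for uniform convergence on
compact sets (\<open>Q_small\<close>), so its transpose maps \<open>G\<close> into itself; the transposes are the required
operators (\<open>MAP_imp_G0_MAP\<close>).

Two tools are used throughout. Holomorphy is checked on complex lines only, which is enough for
Lipschitz functions (\<open>Gateaux_lipschitz_imp_Frechet_holomorphic\<close>). Membership in \<open>G\<close> is
checked by an \<open>\<epsilon>\<close>-\<open>\<delta>\<close> criterion at the origin (\<open>tau0_continuous_iff_small_on_compacts\<close>).
\<close>

section \<open>The Hahn-Banach theorem\<close>

text \<open>A linear functional dominated by \<open>p\<close> is represented by its graph \<open>M\<close>, a subspace of
\<open>'a \<times> real\<close>. Graphs avoid partial functions altogether: adjoining the point \<open>(z, c)\<close> and taking the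
span is the extension of the functional to one more dimension. A suitable \<open>c\<close> exists because every
lower bound \<open>a - p (x - z)\<close> that the domination imposes on it lies below every upper bound
\<open>p (y + z) - b\<close>; the supremum of the lower bounds will do.\<close>

lemma sublinear_extension_one_step:
  fixes p :: "'a::real_vector \<Rightarrow> real"
  assumes sub: "\<And>x y. p (x + y) \<le> p x + p y"
    and hom: "\<And>t x. 0 < t \<Longrightarrow> p (t *\<^sub>R x) = t * p x"
    and M: "subspace M" "\<And>x a. (x, a) \<in> M \<Longrightarrow> a \<le> p x"
  shows "\<exists>c. \<forall>(x, a)\<in>span (insert (z, c) M). a \<le> p x"
proof -
  define c where "c = (SUP (x, a)\<in>M. a - p (x - z))"
  have le: "a - p (x - z) \<le> p (y + z) - b" if "(x, a) \<in> M" "(y, b) \<in> M" for x a y b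
  proof -
    have "(x + y, a + b) \<in> M"
      using subspace_add[OF M(1) that] by simp
    then have "a + b \<le> p ((x - z) + (y + z))"
      using M(2) by simp
    then show ?thesis using sub[of "x - z" "y + z"] by simp
  qed
  have zero: "(0, 0) \<in> M" using subspace_0[OF M(1)] by (simp add: zero_prod_def)
  have lower: "a - p (x - z) \<le> c" if "(x, a) \<in> M" for x a
    unfolding c_def using that
    by (intro cSUP_upper2[OF _ that]) (auto intro!: bdd_aboveI2 le[OF _ zero])
  have upper: "c \<le> p (y + z) - b" if "(y, b) \<in> M" for y b
    unfolding c_def using that zero by (intro cSUP_least) (auto intro: le)
  have "a \<le> p x" if xa: "(x, a) \<in> span (insert (z, c) M)" for x a
  proof -
    obtain t where "(x, a) - t *\<^sub>R (z, c) \<in> span M"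
      using xa span_breakdown_eq by blast
    then have t: "(x - t *\<^sub>R z, a - t * c) \<in> M"
      using M(1) by (simp add: span_eq_iff[THEN iffD2])
    consider "t = 0" | "t > 0" | "t < 0" by linarith
    then show ?thesis
    proof cases
      case 1
      then show ?thesis using M(2) t by simp
    next
      case 2
      have "((1/t) *\<^sub>R (x - t *\<^sub>R z), (a - t * c) / t) \<in> M"
        using subspace_scale[OF M(1) t, of "1/t"] by simp
      from upper[OF this] have "c \<le> p ((1/t) *\<^sub>R x) - (a - t * c) / t"
        using 2 by (simp add: scaleR_diff_right)
      then show ?thesis using 2 hom[of "1/t" x] by (simp add: field_simps)
    next
      case 3
      have "((-1/t) *\<^sub>R (x - t *\<^sub>R z), (-1/t) * (a - t * c)) \<in> M"
        using subspace_scale[OF M(1) t, of "-1/t"] by simp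
      from lower[OF this] have "(-1/t) * (a - t * c) - p ((-1/t) *\<^sub>R x) \<le> c"
        using 3 by (simp add: scaleR_diff_right)
      then show ?thesis using 3 hom[of "-1/t" x] by (simp add: field_simps)
    qed
  qed
  then show ?thesis by blast
qed

text \<open>The Hahn-Banach theorem by Zorn's lemma on dominated graphs. Domination makes every such
graph single-valued: if \<open>(0, a)\<close> lies in it, then so does \<open>(0, - a)\<close>, and both numbers are at most
\<open>p 0 = 0\<close>.\<close>

theorem Hahn_Banach_graph:
  fixes p :: "'a::real_vector \<Rightarrow> real"
  assumes sub: "\<And>x y. p (x + y) \<le> p x + p y"
    and hom: "\<And>t x. 0 < t \<Longrightarrow> p (t *\<^sub>R x) = t * p x"
    and p0: "p 0 = 0"
    and G: "subspace G" "\<And>x a. (x, a) \<in> G \<Longrightarrow> a \<le> p x"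
  obtains U where "linear U" "\<And>x. U x \<le> p x" "\<And>x a. (x, a) \<in> G \<Longrightarrow> U x = a"
proof -
  define A where "A = {M. subspace M \<and> G \<subseteq> M \<and> (\<forall>(x, a)\<in>M. a \<le> p x)}"
  have "\<exists>M\<in>A. \<forall>X\<in>A. M \<subseteq> X \<longrightarrow> X = M"
  proof (rule subset_Zorn_nonempty)
    show "A \<noteq> {}" using G unfolding A_def by blast
    fix C assume C: "C \<noteq> {}" "subset.chain A C"
    then have CA: "\<And>M. M \<in> C \<Longrightarrow> M \<in> A" and lin: "\<And>M N. M \<in> C \<Longrightarrow> N \<in> C \<Longrightarrow> M \<subseteq> N \<or> N \<subseteq> M"
      unfolding subset.chain_def by blast+
    have "subspace (\<Union>C)"
    proof (rule subspaceI)
      show "0 \<in> \<Union>C" using C(1) CA subspace_0 unfolding A_def by blast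
      show "x + y \<in> \<Union>C" if xy: "x \<in> \<Union>C" "y \<in> \<Union>C" for x y
      proof -
        obtain M N where MN: "x \<in> M" "M \<in> C" "y \<in> N" "N \<in> C" using xy by blast
        then obtain L where "x \<in> L" "y \<in> L" "L \<in> C" using lin[of M N] by blast
        then show ?thesis using CA[of L] subspace_add[of L x y] unfolding A_def by blast
      qed
      show "c *\<^sub>R x \<in> \<Union>C" if "x \<in> \<Union>C" for c x
        using that CA subspace_scale unfolding A_def by blast
    qed
    then show "\<Union>C \<in> A" using C(1) CA unfolding A_def by blast
  qed
  then obtain M where MA: "M \<in> A" and max: "\<And>X. X \<in> A \<Longrightarrow> M \<subseteq> X \<Longrightarrow> X = M"
    by blast
  then have M: "subspace M" "G \<subseteq> M" "\<And>x a. (x, a) \<in> M \<Longrightarrow> a \<le> p x"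
    unfolding A_def by auto
  have dom: "\<exists>a. (z, a) \<in> M" for z
  proof -
    obtain c where c: "\<forall>(x, a)\<in>span (insert (z, c) M). a \<le> p x"
      using sublinear_extension_one_step[OF sub hom M(1,3)] by blast
    have sup: "M \<subseteq> span (insert (z, c) M)" by (meson span_superset subset_insertI subset_trans)
    then have "span (insert (z, c) M) \<in> A" unfolding A_def using c M(2) by auto
    then have "span (insert (z, c) M) = M" using max sup by blast
    then show ?thesis using span_superset[of "insert (z, c) M"] by blast
  qed
  have unique: "a = b" if "(x, a) \<in> M" "(x, b) \<in> M" for x a b
  proof -
    have "(0, a - b) \<in> M" "(0, b - a) \<in> M"
      using subspace_diff[OF M(1) that] subspace_diff[OF M(1) that(2,1)] by auto
    then show ?thesis using M(3)[of 0 "a - b"] M(3)[of 0 "b - a"] p0 by simp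
  qed
  obtain U where U: "\<And>x. (x, U x) \<in> M"
    using dom by metis
  show ?thesis
  proof
    show "linear U"
    proof (rule linearI)
      show "U (x + y) = U x + U y" for x y
        using subspace_add[OF M(1) U[of x] U[of y]] unique[OF U[of "x + y"]] by simp
      show "U (r *\<^sub>R x) = r *\<^sub>R U x" for r x
        using subspace_scale[OF M(1) U[of x], of r] unique[OF U[of "r *\<^sub>R x"]] by simp
    qed
    show "U x \<le> p x" for x using M(3) U by blast
    show "U x = a" if "(x, a) \<in> G" for x a using unique U M(2) that by blast
  qed
qed

lemma scaleC_one [simp]: "1 *\<^sub>C x = (x::'a::complex_normed_vector)"
  using scaleC_of_real[of 1 x] by simp

lemma scaleC_zero_left [simp]: "0 *\<^sub>C x = (0::'a::complex_normed_vector)"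
  using scaleC_of_real[of 0 x] by simp

lemma scaleC_zero_right [simp]: "c *\<^sub>C 0 = (0::'a::complex_normed_vector)"
  using norm_scaleC[of c "0::'a"] by simp

lemma scaleC_minus_left [simp]: "(- c) *\<^sub>C x = - (c *\<^sub>C (x::'a::complex_normed_vector))"
  using scaleC_add_left[of "-c" c x] by (simp add: eq_neg_iff_add_eq_0)

lemma scaleC_diff_right: "c *\<^sub>C (x - y) = c *\<^sub>C x - c *\<^sub>C (y::'a::complex_normed_vector)"
  using scaleC_add_right[of c "x - y" y] by (simp add: algebra_simps)

text \<open>Linearity without boundedness, so that the algebra of functionals can be used before a norm
bound is known.\<close>

definition complex_linear :: "('a::complex_normed_vector \<Rightarrow> 'b::complex_normed_vector) \<Rightarrow> bool"
  where "complex_linear T \<longleftrightarrow> (\<forall>x y. T (x + y) = T x + T y) \<and> (\<forall>c x. T (c *\<^sub>C x) = c *\<^sub>C T x)"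

lemma complex_linear_diff: "complex_linear T \<Longrightarrow> T (x - y) = T x - T y"
  using scaleC_minus_left[of 1 y] scaleC_minus_left[of 1 "T y"] unfolding complex_linear_def
  by (metis diff_conv_add_uminus scaleC_one)

lemma bounded_clinearD: "bounded_clinear T \<Longrightarrow> complex_linear T"
  unfolding complex_linear_def bounded_clinear_def by (simp add: linear_simps)

lemma bounded_clinearI:
  assumes "complex_linear T" "\<And>x. norm (T x) \<le> C * norm x"
  shows "bounded_clinear T"
proof -
  have "T (r *\<^sub>R x) = r *\<^sub>R T x" for r x
    using assms(1) unfolding complex_linear_def by (metis scaleC_of_real)
  then show ?thesis
    using assms unfolding bounded_clinear_def complex_linear_def
    by (auto intro!: bounded_linear_intro[of _ C] simp: mult.commute)
qed

text \<open>A complex functional is determined by its real part through \<open>F x = U x - i U (i x)\<close>. The bound on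
\<open>|F|\<close> follows from the one on \<open>U\<close> by rotating \<open>x\<close> until \<open>F x\<close> is real and nonnegative.\<close>

lemma complexify_functional:
  fixes U :: "'a::complex_normed_vector \<Rightarrow> real"
  assumes lin: "linear U" and le: "\<And>x. U x \<le> p x"
    and p: "\<And>c x. p (c *\<^sub>C x) = cmod c * p x"
  shows "\<exists>F. complex_linear F \<and> (\<forall>x. cmod (F x) \<le> p x) \<and> (\<forall>x. Re (F x) = U x)"
proof -
  define F where "F x = Complex (U x) (- U (\<i> *\<^sub>C x))" for x
  have scal: "U (c *\<^sub>C x) = Re c * U x + Im c * U (\<i> *\<^sub>C x)" for c x
  proof -
    have "c *\<^sub>C x = Re c *\<^sub>R x + Im c *\<^sub>R (\<i> *\<^sub>C x)"
      unfolding scaleC_of_real[symmetric] scaleC_scaleC scaleC_add_left[symmetric]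
      by (metis complex_eq mult.commute)
    then show ?thesis by (simp add: linear_add[OF lin] linear_scale[OF lin])
  qed
  have lF: "complex_linear F"
    unfolding complex_linear_def
  proof (intro conjI allI)
    show "F (x + y) = F x + F y" for x y
      by (simp add: F_def complex_eq_iff scaleC_add_right linear_add[OF lin])
    show "F (c *\<^sub>C x) = c *\<^sub>C F x" for c x
      using scal[of c x] scal[of "\<i> * c" x]
      by (simp add: F_def complex_eq_iff scaleC_scaleC algebra_simps)
  qed
  have "cmod (F x) \<le> p x" for x
  proof (cases "F x = 0")
    case True
    have "U x \<le> p x" "- U x \<le> p x"
      using le[of x] le[of "-1 *\<^sub>C x"] p[of "-1" x] scal[of "-1" x] by auto
    then show ?thesis using True by simp
  next
    case False
    define c where "c = cnj (F x) / cmod (F x)"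
    have c: "cmod c = 1" "c * F x = cmod (F x)"
      using False by (auto simp: c_def norm_divide complex_norm_square[symmetric] power2_eq_square
          mult.commute[of "cnj _"] field_simps)
    have "cmod (F x) = Re (F (c *\<^sub>C x))"
      using lF c(2) unfolding complex_linear_def by simp
    also have "\<dots> \<le> p (c *\<^sub>C x)" using le by (simp add: F_def)
    finally show ?thesis using p c(1) by simp
  qed
  moreover have "Re (F x) = U x" for x by (simp add: F_def)
  ultimately show ?thesis using lF by blast
qed

lemma norming_functional:
  fixes x :: "'a::complex_normed_vector"
  obtains F :: "'a \<Rightarrow> complex"
  where "complex_linear F" "\<And>y. cmod (F y) \<le> norm y" "norm x \<le> cmod (F x)"
proof -
  have "a \<le> norm y" if "(y, a) \<in> span {(x, norm x)}" for y a
  proof -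
    have "\<exists>t. y = t *\<^sub>R x \<and> a = t * norm x"
      using that by (auto simp: span_singleton)
    then show ?thesis by (auto intro!: mult_right_mono)
  qed
  then obtain U where U: "linear U" "\<And>y. U y \<le> norm y"
    and ext: "\<And>y a. (y, a) \<in> span {(x, norm x)} \<Longrightarrow> U y = a"
    using Hahn_Banach_graph[of norm "span {(x, norm x)}"] by (auto simp: norm_triangle_ineq)
  have Ux: "U x = norm x"
    by (rule ext) (simp add: span_base)
  obtain F where F: "complex_linear F" "\<And>y. cmod (F y) \<le> norm y" "\<And>y. Re (F y) = U y"
    using complexify_functional[OF U(1,2) norm_scaleC] by auto
  have "norm x \<le> cmod (F x)"
    using complex_Re_le_cmod[of "F x"] F(3)[of x] Ux by simp
  with F(1,2) show ?thesis by (rule that)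
qed

text \<open>The real part of \<open>w\<close> is extended and then complexified. On \<open>N\<close> the result agrees with \<open>w\<close> because
\<open>N\<close> is closed under multiplication by \<open>i\<close>, so that the real parts determine both functionals there.\<close>

lemma Hahn_Banach_complex:
  fixes w :: "'a::complex_normed_vector \<Rightarrow> complex"
  assumes N: "0 \<in> N" "\<And>x y. x \<in> N \<Longrightarrow> y \<in> N \<Longrightarrow> x + y \<in> N" "\<And>c x. x \<in> N \<Longrightarrow> c *\<^sub>C x \<in> N"
    and w: "complex_linear w" "\<And>x. x \<in> N \<Longrightarrow> cmod (w x) \<le> C * norm x" and C: "0 \<le> C"
  obtains F where "complex_linear F" "\<And>x. cmod (F x) \<le> C * norm x" "\<And>x. x \<in> N \<Longrightarrow> F x = w x"
proof -
  have sub: "C * norm (x + y) \<le> C * norm x + C * norm y" for x y :: 'a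
    using mult_left_mono[OF norm_triangle_ineq C, of x y] by (simp add: distrib_left)
  define G where "G = (\<lambda>x. (x, Re (w x))) ` N"
  have wR: "w (r *\<^sub>R x) = r *\<^sub>R w x" for r x
    using w(1) unfolding complex_linear_def by (metis scaleC_of_real)
  have NR: "r *\<^sub>R x \<in> N" if "x \<in> N" for r x using N(3)[OF that, of "of_real r"] by (simp add: scaleC_of_real)
  have G: "subspace G"
  proof (rule subspaceI)
    have "w 0 = 0" using wR[of 0 0] by simp
    then show "0 \<in> G" unfolding G_def using N(1) by (auto simp: zero_prod_def image_iff)
    show "x + y \<in> G" if "x \<in> G" "y \<in> G" for x y
      using that N(2) w(1) unfolding G_def complex_linear_def by (auto simp: image_iff)
    show "r *\<^sub>R x \<in> G" if "x \<in> G" for r x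
      using that NR wR unfolding G_def by (auto simp: image_iff)
  qed
  have Gle: "a \<le> C * norm x" if "(x, a) \<in> G" for x a
    using that w(2) complex_Re_le_cmod order_trans unfolding G_def by blast
  obtain U where U: "linear U" "\<And>y. U y \<le> C * norm y" "\<And>x a. (x, a) \<in> G \<Longrightarrow> U x = a"
    using Hahn_Banach_graph[of "\<lambda>x. C * norm x", OF sub _ _ G Gle] by auto
  obtain F where F: "complex_linear F" "\<And>y. cmod (F y) \<le> C * norm y" "\<And>y. Re (F y) = U y"
    using complexify_functional[OF U(1,2)] by (auto simp: norm_scaleC)
  have Re: "Re (F x) = Re (w x)" if "x \<in> N" for x
    using U(3)[of x "Re (w x)"] that F(3) unfolding G_def by auto
  have "F x = w x" if "x \<in> N" for x
    using Re[OF that] Re[OF N(3)[OF that, of "\<i>"]] F(1) w(1)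
    unfolding complex_linear_def by (simp add: complex_eq_iff)
  then show ?thesis using that F by blast
qed

text \<open>Finitely many equations \<open>v i f = 0\<close> imply \<open>w f = 0\<close> only if \<open>w\<close> is a combination of the \<open>v i\<close>. This turns
two statements about zeros, on finite sets of points and of homogeneous parts, into statements
about spans.\<close>

lemma functional_in_span_of_functionals:
  fixes v :: "'i \<Rightarrow> 'b::complex_normed_vector \<Rightarrow> complex"
  assumes "finite I" "\<And>i. i \<in> I \<Longrightarrow> complex_linear (v i)" "complex_linear w"
    and "\<And>f. (\<And>i. i \<in> I \<Longrightarrow> v i f = 0) \<Longrightarrow> w f = 0"
  shows "\<exists>c. \<forall>f. w f = (\<Sum>i\<in>I. c i * v i f)"
  using assms
proof (induction I arbitrary: w rule: finite_induct)
  case empty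
  then show ?case by simp
next
  case (insert i I)
  show ?case
  proof (cases "\<exists>e. (\<forall>j\<in>I. v j e = 0) \<and> v i e \<noteq> 0")
    case False
    have "\<exists>c. \<forall>f. w f = (\<Sum>j\<in>I. c j * v j f)"
    proof (rule insert.IH)
      show "w f = 0" if "\<And>j. j \<in> I \<Longrightarrow> v j f = 0" for f
        using False that by (intro insert.prems(3)) auto
    qed (use insert.prems in auto)
    then obtain c where "\<forall>f. w f = (\<Sum>j\<in>I. c j * v j f)" ..
    then show ?thesis
      using insert.hyps by (intro exI[of _ "c(i := 0)"]) (auto intro!: sum.cong)
  next
    case True
    then obtain e where e: "\<And>j. j \<in> I \<Longrightarrow> v j e = 0" "v i e \<noteq> 0" by blast
    define a where "a = w e / v i e"
    have lin: "complex_linear (\<lambda>f. w f - a * v i f)"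
      using insert.prems(1)[of i] insert.prems(2) unfolding complex_linear_def
      by (simp add: algebra_simps)
    have "w f - a * v i f = 0" if f: "\<And>j. j \<in> I \<Longrightarrow> v j f = 0" for f
    proof -
      have "w (f - (v i f / v i e) *\<^sub>C e) = 0"
      proof (rule insert.prems(3))
        fix j assume j: "j \<in> insert i I"
        then have "v j (f - (v i f / v i e) *\<^sub>C e) = v j f - (v i f / v i e) * v j e"
          using insert.prems(1)[of j] complex_linear_diff[of "v j"] unfolding complex_linear_def by simp
        then show "v j (f - (v i f / v i e) *\<^sub>C e) = 0" using j e f by auto
      qed
      then show ?thesis
        using insert.prems(2) complex_linear_diff[OF insert.prems(2)] unfolding complex_linear_def a_def by simp
    qed
    then have "\<exists>c. \<forall>f. w f - a * v i f = (\<Sum>j\<in>I. c j * v j f)"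
      using insert.prems(1) by (intro insert.IH lin) auto
    then obtain c where "\<forall>f. w f - a * v i f = (\<Sum>j\<in>I. c j * v j f)" ..
    moreover have "(\<Sum>j\<in>I. (c(i := a)) j * v j f) = (\<Sum>j\<in>I. c j * v j f)" for f
      using insert.hyps by (intro sum.cong) auto
    ultimately have "w f = (\<Sum>j\<in>insert i I. (c(i := a)) j * v j f)" for f
      using insert.hyps by (simp add: diff_eq_eq)
    then show ?thesis by blast
  qed
qed

section \<open>Taylor coefficients in one complex variable\<close>

definition taylor_coeff :: "nat \<Rightarrow> (complex \<Rightarrow> complex) \<Rightarrow> complex"
  where "taylor_coeff k g = (deriv ^^ k) g 0 / fact k"

lemma taylor_coeff_0: "taylor_coeff 0 g = g 0"
  by (simp add: taylor_coeff_def)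

lemma taylor_coeff_add:
  assumes "g holomorphic_on S" "h holomorphic_on S" "open S" "0 \<in> S"
  shows "taylor_coeff k (\<lambda>z. g z + h z) = taylor_coeff k g + taylor_coeff k h"
  unfolding taylor_coeff_def using assms by (simp add: higher_deriv_add add_divide_distrib)

lemma taylor_coeff_diff:
  assumes "g holomorphic_on S" "h holomorphic_on S" "open S" "0 \<in> S"
  shows "taylor_coeff k (\<lambda>z. g z - h z) = taylor_coeff k g - taylor_coeff k h"
  unfolding taylor_coeff_def using assms by (simp add: higher_deriv_diff diff_divide_distrib)

lemma taylor_coeff_cmult:
  assumes "g holomorphic_on S" "open S" "0 \<in> S"
  shows "taylor_coeff k (\<lambda>z. c * g z) = c * taylor_coeff k g"
  unfolding taylor_coeff_def using assms by (simp add: higher_deriv_cmult)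

lemma taylor_coeff_dilate:
  assumes "g holomorphic_on S" "open S" "0 \<in> S"
  shows "taylor_coeff k (\<lambda>z. g (c * z)) = c ^ k * taylor_coeff k g"
proof -
  have "open ((\<lambda>w. c * w) -` S)"
    using assms(2) by (intro open_vimage continuous_intros)
  then have "(deriv ^^ k) (\<lambda>z. g (c * z)) 0 = c ^ k * (deriv ^^ k) g (c * 0)"
    using assms
    by (intro higher_deriv_compose_linear[where S = "(\<lambda>w. c * w) -` S" and T = S]) auto
  then show ?thesis by (simp add: taylor_coeff_def)
qed

lemma taylor_coeff_bound:
  assumes hol: "g holomorphic_on S" "cball 0 R \<subseteq> S" and R: "0 < R"
    and M: "\<And>z. cmod z = R \<Longrightarrow> cmod (g z) \<le> M"
  shows "cmod (taylor_coeff k g) \<le> M / R ^ k"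
proof -
  have g: "g holomorphic_on cball 0 R" using hol holomorphic_on_subset by blast
  have "cmod ((deriv ^^ k) g 0) \<le> fact k * M / R ^ k"
    using g R M
    by (intro Cauchy_inequality)
      (auto intro: holomorphic_on_imp_continuous_on holomorphic_on_subset[OF _ ball_subset_cball])
  then show ?thesis by (simp add: taylor_coeff_def norm_divide field_simps)
qed

text \<open>Cauchy's estimates dominate the tail of the power series by a geometric series.\<close>

lemma taylor_remainder_bound:
  assumes hol: "g holomorphic_on S" "cball 0 R \<subseteq> S" and R: "0 < R"
    and M: "\<And>z. cmod z = R \<Longrightarrow> cmod (g z) \<le> M"
    and z: "cmod z < R"
  shows "cmod (g z - (\<Sum>k\<le>n. taylor_coeff k g * z ^ k))
    \<le> M * (cmod z / R) ^ Suc n / (1 - cmod z / R)"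
proof -
  define q where "q = cmod z / R"
  have q: "0 \<le> q" "q < 1" using R z by (auto simp: q_def)
  have "g holomorphic_on ball 0 R"
    using hol holomorphic_on_subset ball_subset_cball by blast
  from holomorphic_power_series[OF this, of z] z
  have "(\<lambda>k. taylor_coeff k g * z ^ k) sums g z"
    by (simp add: taylor_coeff_def)
  from sums_split_initial_segment[OF this, of "Suc n"]
  have tail: "(\<lambda>i. taylor_coeff (i + Suc n) g * z ^ (i + Suc n)) sums
      (g z - (\<Sum>k\<le>n. taylor_coeff k g * z ^ k))"
    by (simp add: lessThan_Suc_atMost)
  have geo: "(\<lambda>i. M * q ^ Suc n * q ^ i) sums (M * q ^ Suc n * (1 / (1 - q)))"
    using q by (intro sums_mult geometric_sums) auto
  have le: "norm (taylor_coeff (i + Suc n) g * z ^ (i + Suc n)) \<le> M * q ^ Suc n * q ^ i" for i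
  proof -
    have "norm (taylor_coeff (i + Suc n) g * z ^ (i + Suc n))
        \<le> M / R ^ (i + Suc n) * cmod z ^ (i + Suc n)"
      unfolding norm_mult norm_power
      by (intro mult_right_mono taylor_coeff_bound[OF hol R M]) auto
    also have "\<dots> = M * q ^ (i + Suc n)" by (simp add: q_def power_divide)
    finally show ?thesis by (simp add: power_add mult_ac)
  qed
  have "cmod (g z - (\<Sum>k\<le>n. taylor_coeff k g * z ^ k)) \<le> M * q ^ Suc n * (1 / (1 - q))"
    using norm_suminf_le[OF le sums_summable[OF geo]] sums_unique[OF tail] sums_unique[OF geo]
    by simp
  then show ?thesis by (simp add: q_def)
qed

lemma taylor_remainder_bound_half:
  assumes hol: "g holomorphic_on S" "cball 0 R \<subseteq> S" and R: "0 < R"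
    and M: "\<And>z. cmod z = R \<Longrightarrow> cmod (g z) \<le> M"
    and z: "cmod z \<le> R / 2"
  shows "cmod (g z - (\<Sum>k\<le>n. taylor_coeff k g * z ^ k)) \<le> 2 * M * (cmod z / R) ^ Suc n"
proof -
  have M0: "0 \<le> M" using M[of "of_real R"] R by (smt (verit) norm_ge_zero norm_of_real)
  define q where "q = cmod z / R"
  have q: "0 \<le> q" "1 / 2 \<le> 1 - q" using R z by (auto simp: q_def field_simps)
  have "cmod (g z - (\<Sum>k\<le>n. taylor_coeff k g * z ^ k)) \<le> M * q ^ Suc n / (1 - q)"
    using taylor_remainder_bound[OF hol R M, of z n] z R unfolding q_def by simp
  also have "\<dots> \<le> M * q ^ Suc n / (1 / 2)"
    using q M0 by (intro divide_left_mono) auto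
  finally show ?thesis by (simp add: q_def mult_ac)
qed

section \<open>Holomorphy along complex lines\<close>

lemma bounded_bilinear_scaleC:
  "bounded_bilinear (scaleC :: complex \<Rightarrow> 'a::complex_normed_vector \<Rightarrow> 'a)"
proof
  fix a b c :: complex and x y :: 'a and r :: real
  show "(r *\<^sub>R c) *\<^sub>C x = r *\<^sub>R c *\<^sub>C x" "c *\<^sub>C r *\<^sub>R x = r *\<^sub>R c *\<^sub>C x"
    unfolding scaleC_of_real[symmetric] scaleC_scaleC by (simp_all add: scaleR_conv_of_real mult.commute)
  show "\<exists>K. \<forall>(c::complex) (x::'a). norm (c *\<^sub>C x) \<le> norm c * norm x * K"
    by (rule exI[of _ 1]) (simp add: norm_scaleC)
qed (simp_all add: scaleC_add_left scaleC_add_right)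

lemmas continuous_on_scaleC [continuous_intros] = bounded_bilinear.continuous_on[OF bounded_bilinear_scaleC]

definition line_domain :: "'a::complex_normed_vector \<Rightarrow> 'a \<Rightarrow> complex set"
  where "line_domain x y = {c. x + c *\<^sub>C y \<in> ball 0 1}"

text \<open>Gateaux holomorphy reduces questions on the ball of a Banach space to functions of one complex
variable. The parameter domain \<open>line_domain x y\<close> is the slice of the ball by the line through
\<open>x\<close> in direction \<open>y\<close>.\<close>

definition Gateaux_holomorphic :: "('a::complex_normed_vector \<Rightarrow> complex) \<Rightarrow> bool"
  where "Gateaux_holomorphic f \<longleftrightarrow>
    (\<forall>x y. (\<lambda>c. f (x + c *\<^sub>C y)) holomorphic_on line_domain x y)"

lemma open_line_domain: "open (line_domain x y)"
proof -
  have "line_domain x y = (\<lambda>c. x + c *\<^sub>C y) -` ball 0 1" unfolding line_domain_def by auto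
  then show ?thesis by (auto intro!: open_vimage continuous_intros)
qed

lemma cball_subset_line_domain:
  assumes "norm x + R * norm y < 1"
  shows "cball 0 R \<subseteq> line_domain x y"
proof
  fix c :: complex assume "c \<in> cball 0 R"
  then have "norm (c *\<^sub>C y) \<le> R * norm y"
    by (simp add: norm_scaleC mult_right_mono)
  then show "c \<in> line_domain x y"
    using norm_triangle_ineq[of x "c *\<^sub>C y"] assms by (simp add: line_domain_def)
qed

lemma Frechet_imp_Gateaux_holomorphic:
  assumes "holomorphic_on_unit_ball f"
  shows "Gateaux_holomorphic f"
  unfolding Gateaux_holomorphic_def
proof (intro allI)
  fix x y :: 'a
  show "(\<lambda>c. f (x + c *\<^sub>C y)) holomorphic_on line_domain x y"
    unfolding holomorphic_on_def field_differentiable_def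
  proof (intro ballI)
    fix c assume "c \<in> line_domain x y"
    then obtain A where A: "bounded_clinear A" "(f has_derivative A) (at (x + c *\<^sub>C y))"
      using assms unfolding holomorphic_on_unit_ball_def line_domain_def by blast
    have "((\<lambda>c. x + c *\<^sub>C y) has_derivative (\<lambda>h. h *\<^sub>C y)) (at c)"
      using bounded_linear.has_derivative[OF bounded_bilinear.bounded_linear_left[OF bounded_bilinear_scaleC]
          has_derivative_ident, of y "at c"]
      by (auto intro!: has_derivative_add_const derivative_eq_intros)
    from has_derivative_compose[OF this A(2)]
    have "((\<lambda>c. f (x + c *\<^sub>C y)) has_derivative (\<lambda>h. A (h *\<^sub>C y))) (at c)" .
    moreover have "(\<lambda>h. A (h *\<^sub>C y)) = (*) (A y)"
      using A(1) by (auto simp: bounded_clinear_def mult.commute)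
    ultimately have "((\<lambda>c. f (x + c *\<^sub>C y)) has_field_derivative A y) (at c)"
      by (simp add: has_field_derivative_def)
    then show "\<exists>D. ((\<lambda>c. f (x + c *\<^sub>C y)) has_field_derivative D) (at c within line_domain x y)"
      using has_field_derivative_at_within by blast
  qed
qed

lemma Gateaux_holomorphicD:
  "Gateaux_holomorphic f \<Longrightarrow> (\<lambda>c. f (x + c *\<^sub>C y)) holomorphic_on line_domain x y"
  by (simp add: Gateaux_holomorphic_def)

definition line_deriv :: "('a::complex_normed_vector \<Rightarrow> complex) \<Rightarrow> 'a \<Rightarrow> 'a \<Rightarrow> complex"
  where "line_deriv f x y = deriv (\<lambda>c. f (x + c *\<^sub>C y)) 0"

lemma zero_in_line_domain: "x \<in> ball 0 1 \<Longrightarrow> 0 \<in> line_domain x y"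
  by (simp add: line_domain_def)

lemma line_deriv_limit:
  assumes "Gateaux_holomorphic f" "x \<in> ball 0 1"
  shows "((\<lambda>t. (f (x + t *\<^sub>C y) - f x) / t) \<longlongrightarrow> line_deriv f x y) (at 0)"
proof -
  have "((\<lambda>c. f (x + c *\<^sub>C y)) has_field_derivative line_deriv f x y) (at 0)"
    unfolding line_deriv_def
    by (intro holomorphic_derivI[OF Gateaux_holomorphicD[OF assms(1)] open_line_domain zero_in_line_domain] assms)
  then show ?thesis by (simp add: DERIV_def)
qed

lemma line_deriv_scaleC:
  assumes "Gateaux_holomorphic f" "x \<in> ball 0 1"
  shows "line_deriv f x (c *\<^sub>C y) = c * line_deriv f x y"
  using taylor_coeff_dilate[OF Gateaux_holomorphicD[OF assms(1)] open_line_domain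
      zero_in_line_domain[OF assms(2)], of 1 c y]
  by (simp add: taylor_coeff_def line_deriv_def scaleC_scaleC mult.commute)

lemma Gateaux_lipschitz_circle_bound:
  assumes lip: "C-lipschitz_on (ball 0 1) f" and x: "norm x + R * norm y < 1" "0 < R"
    and z: "cmod z = R"
  shows "cmod (f (x + z *\<^sub>C y) - f x) \<le> C * (R * norm y)"
proof -
  have "z \<in> line_domain x y" using cball_subset_line_domain[OF x(1)] z by auto
  moreover have "norm x < 1" using x by (smt (verit) mult_nonneg_nonneg norm_ge_zero)
  ultimately have "dist (f (x + z *\<^sub>C y)) (f x) \<le> C * dist (x + z *\<^sub>C y) x"
    by (intro lipschitz_onD[OF lip]) (auto simp: line_domain_def)
  then show ?thesis using z by (simp add: dist_norm norm_scaleC)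
qed

text \<open>The function \<open>c \<mapsto> f (x + c h) - f x\<close> is holomorphic on a disc of radius proportional to \<open>1 / norm h\<close>,
where the Lipschitz condition bounds it by a constant independent of \<open>h\<close>. Its Taylor remainder of
order two at \<open>c = 1\<close> is therefore of order \<open>(norm h)\<^sup>2\<close>, uniformly in the direction of \<open>h\<close>.\<close>

lemma line_deriv_remainder:
  assumes lip: "C-lipschitz_on (ball 0 1) f" and hol: "Gateaux_holomorphic f"
    and h: "norm h \<le> (1 - norm x) / 4" and x: "norm x < 1"
  shows "cmod (f (x + h) - f x - line_deriv f x h) \<le> 4 * C / (1 - norm x) * (norm h)\<^sup>2"
proof (cases "h = 0")
  case True
  have "line_deriv f x 0 = 0" using line_deriv_scaleC[OF hol, of x 0 0] x by simp
  then show ?thesis using True by simp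
next
  case False
  \<comment> \<open>The line stays inside the ball, with room to spare, for parameters up to this radius.\<close>
  define R where "R = (1 - norm x) / (2 * norm h)"
  have R: "0 < R" "norm x + R * norm h < 1" "R * norm h = (1 - norm x) / 2" "1 \<le> R / 2"
    using False h x by (auto simp: R_def field_simps)
  let ?g = "\<lambda>c. f (x + c *\<^sub>C h) - f x"
  have g: "?g holomorphic_on line_domain x h"
    by (intro holomorphic_intros Gateaux_holomorphicD hol)
  have 1: "taylor_coeff 1 ?g = line_deriv f x h"
    using x unfolding taylor_coeff_def line_deriv_def
    by (simp add: deriv_diff holomorphic_on_imp_differentiable_at[OF Gateaux_holomorphicD[OF hol] open_line_domain]
        zero_in_line_domain)
  have "cmod (?g 1 - (\<Sum>k\<le>1. taylor_coeff k ?g * 1 ^ k)) \<le> 2 * (C * (R * norm h)) * (cmod 1 / R) ^ Suc 1"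
    by (rule taylor_remainder_bound_half[OF g cball_subset_line_domain])
      (use R(2,1,4) Gateaux_lipschitz_circle_bound[OF lip R(2,1)] in auto)
  moreover have "2 * (C * (R * norm h)) * (cmod 1 / R) ^ Suc 1 = 4 * C / (1 - norm x) * (norm h)\<^sup>2"
  proof -
    define d where "d = 1 - norm x"
    have "d \<noteq> 0" "norm h \<noteq> 0" using False x by (auto simp: d_def)
    then show ?thesis
      unfolding R(3) unfolding R_def d_def[symmetric] by (simp add: power2_eq_square field_simps)
  qed
  ultimately show ?thesis using 1 by (simp add: taylor_coeff_0)
qed

text \<open>The defect of additivity is the limit of a mixed second difference of \<open>f\<close> divided by \<open>t\<close>. That
difference is a first difference, in the variable \<open>c\<close>, of \<open>c \<mapsto> f (x + t h + c k) - f (x + c k)\<close>; this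
function is holomorphic and, by the Lipschitz condition, of size \<open>O(t)\<close>, so the mixed difference is
\<open>O(t\<^sup>2)\<close> and the defect vanishes.\<close>

lemma line_deriv_add:
  assumes lip: "C-lipschitz_on (ball 0 1) f" and hol: "Gateaux_holomorphic f" and x: "norm x < 1"
  shows "line_deriv f x (h + k) = line_deriv f x h + line_deriv f x k"
proof -
  \<comment> \<open>The quotient of a mixed second difference; it tends to the defect of additivity.\<close>
  define u where "u t = (f (x + t *\<^sub>C (h + k)) - f x) / t - (f (x + t *\<^sub>C h) - f x) / t
    - (f (x + t *\<^sub>C k) - f x) / t" for t :: complex
  have lim: "(u \<longlongrightarrow> line_deriv f x (h + k) - line_deriv f x h - line_deriv f x k) (at 0)"
    unfolding u_def by (intro tendsto_diff line_deriv_limit hol) (use x in auto)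
  define d where "d = 1 - norm x"
  define R where "R = d / (4 * (1 + norm k))"
  define r where "r = min (R / 2) (d / (4 * (1 + norm h)))"
  have d: "0 < d" using x by (simp add: d_def)
  have R: "0 < R" "R * norm k \<le> d / 4"
    using d by (auto simp: R_def field_simps add_pos_nonneg)
  have r: "0 < r" "r \<le> R / 2" "r * norm h \<le> d / 4"
  proof -
    show "0 < r" using d R by (auto simp: r_def add_pos_nonneg)
    show "r \<le> R / 2" unfolding r_def by (rule min.cobounded1)
    have "r * norm h \<le> d / (4 * (1 + norm h)) * norm h"
      by (intro mult_right_mono) (auto simp: r_def)
    also have "\<dots> \<le> d / 4" using d by (auto simp: field_simps add_pos_nonneg)
    finally show "r * norm h \<le> d / 4" .
  qed
  have bound: "cmod (u t) \<le> (2 * C * norm h / R) * cmod t" if t: "t \<noteq> 0" "cmod t < r" for t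
  proof -
    let ?g = "\<lambda>c. f (x + t *\<^sub>C h + c *\<^sub>C k) - f (x + c *\<^sub>C k)"
    have th: "norm (t *\<^sub>C h) \<le> d / 4"
      using t r(3) mult_right_mono[of "cmod t" r "norm h"] by (simp add: norm_scaleC)
    have in1: "norm (x + t *\<^sub>C h) + R * norm k < 1"
    proof -
      have "norm (x + t *\<^sub>C h) + R * norm k \<le> (norm x + d / 4) + d / 4"
        using th R(2) norm_triangle_ineq[of x "t *\<^sub>C h"] by (intro add_mono) auto
      then show ?thesis using d by (simp add: d_def field_simps)
    qed
    have in2: "norm x + R * norm k < 1"
    proof -
      have "norm x + R * norm k \<le> norm x + d / 4" using R(2) by simp
      then show ?thesis using d by (simp add: d_def field_simps)
    qed
    have g: "?g holomorphic_on (line_domain (x + t *\<^sub>C h) k \<inter> line_domain x k)"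
      by (intro holomorphic_on_diff)
        (auto intro: holomorphic_on_subset[OF Gateaux_holomorphicD[OF hol]])
    have "cmod (?g t - (\<Sum>j\<le>0. taylor_coeff j ?g * t ^ j)) \<le> 2 * (C * norm (t *\<^sub>C h)) * (cmod t / R) ^ Suc 0"
    proof (rule taylor_remainder_bound_half[OF g])
      show "cball 0 R \<subseteq> line_domain (x + t *\<^sub>C h) k \<inter> line_domain x k"
        using cball_subset_line_domain[OF in1] cball_subset_line_domain[OF in2] by auto
      fix c assume c: "cmod c = R"
      then have "c \<in> line_domain (x + t *\<^sub>C h) k" "c \<in> line_domain x k"
        using cball_subset_line_domain[OF in1] cball_subset_line_domain[OF in2] by auto
      then have "dist (f (x + t *\<^sub>C h + c *\<^sub>C k)) (f (x + c *\<^sub>C k))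
          \<le> C * dist (x + t *\<^sub>C h + c *\<^sub>C k) (x + c *\<^sub>C k)"
        by (intro lipschitz_onD[OF lip]) (auto simp: line_domain_def)
      then show "cmod (?g c) \<le> C * norm (t *\<^sub>C h)" by (simp add: dist_norm)
    qed (use R r t in auto)
    moreover have "u t * t = ?g t - (f (x + t *\<^sub>C h) - f x)"
      using t by (simp add: u_def field_simps scaleC_add_right)
    ultimately have "cmod (u t) * cmod t \<le> (2 * C * norm h / R * cmod t) * cmod t"
      by (simp add: taylor_coeff_0 norm_scaleC norm_mult[symmetric] mult_ac)
    then show ?thesis by (rule mult_right_le_imp_le) (use t in simp)
  qed
  have "(u \<longlongrightarrow> 0) (at 0)"
  proof (rule Lim_null_comparison)
    show "\<forall>\<^sub>F t in at 0. cmod (u t) \<le> (2 * C * norm h / R) * cmod t"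
      unfolding eventually_at using r(1) bound by (intro exI[of _ r]) auto
    show "((\<lambda>t. (2 * C * norm h / R) * cmod t) \<longlongrightarrow> 0) (at 0)"
      by (intro tendsto_eq_intros) auto
  qed
  with lim have "line_deriv f x (h + k) - line_deriv f x h - line_deriv f x k = 0"
    using tendsto_unique[OF _ lim] by simp
  then show ?thesis by (simp add: algebra_simps)
qed

text \<open>All holomorphic functions constructed below are obtained along lines; this is what makes them
elements of the space of holomorphic Lipschitz functions.\<close>

theorem Gateaux_lipschitz_imp_Frechet_holomorphic:
  assumes lip: "C-lipschitz_on (ball 0 1) f" and hol: "Gateaux_holomorphic f"
  shows "holomorphic_on_unit_ball f"
  unfolding holomorphic_on_unit_ball_def
proof
  fix x :: 'a assume "x \<in> ball 0 1"
  then have x: "norm x < 1" by simp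
  let ?A = "line_deriv f x"
  have lin: "complex_linear ?A"
    unfolding complex_linear_def using line_deriv_add[OF lip hol x] line_deriv_scaleC[OF hol] x by simp
  have "cmod (?A y) \<le> C * norm y" for y
  proof (rule tendsto_upperbound[OF tendsto_norm[OF line_deriv_limit[OF hol, of x y]]])
    have "open (line_domain x y)" "0 \<in> line_domain x y"
      using open_line_domain x zero_in_line_domain by auto
    then have "\<forall>\<^sub>F t in at 0. t \<in> line_domain x y" by (rule eventually_at_in_open')
    then show "\<forall>\<^sub>F t in at 0. cmod ((f (x + t *\<^sub>C y) - f x) / t) \<le> C * norm y"
      using eventually_neq_at_within[of 0]
    proof eventually_elim
      case (elim t)
      then have "dist (f (x + t *\<^sub>C y)) (f x) \<le> C * dist (x + t *\<^sub>C y) x"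
        using x by (intro lipschitz_onD[OF lip]) (auto simp: line_domain_def)
      then show ?case using elim by (simp add: dist_norm norm_scaleC norm_divide field_simps)
    qed
  qed (use x in auto)
  then have bc: "bounded_clinear ?A" by (rule bounded_clinearI[OF lin])
  moreover have "(f has_derivative ?A) (at x)"
    unfolding has_derivative_at
  proof
    show "bounded_linear ?A" using bc by (simp add: bounded_clinear_def)
    let ?K = "4 * C / (1 - norm x)"
    show "((\<lambda>h. norm (f (x + h) - f x - ?A h) / norm h) \<longlongrightarrow> 0) (at 0)"
    proof (rule Lim_null_comparison)
      have "\<forall>\<^sub>F h in at 0. h \<in> ball (0::'a) ((1 - norm x) / 4)"
        using x by (intro eventually_at_in_open') auto
      then show "\<forall>\<^sub>F h in at 0. norm (norm (f (x + h) - f x - ?A h) / norm h) \<le> ?K * norm h"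
        using eventually_neq_at_within[of 0]
      proof eventually_elim
        case (elim h)
        then have "cmod (f (x + h) - f x - ?A h) \<le> (?K * norm h) * norm h"
          using line_deriv_remainder[OF lip hol, of h x] x by (simp add: power2_eq_square)
        then show ?case using elim by (simp add: divide_le_eq)
      qed
      show "((\<lambda>h. ?K * norm h) \<longlongrightarrow> 0) (at 0)"
        by (intro tendsto_eq_intros) auto
    qed
  qed
  ultimately show "\<exists>A. bounded_clinear A \<and> (f has_derivative A) (at x)" by blast
qed

section \<open>Homogeneous parts of a holomorphic Lipschitz function\<close>

interpretation cvs: vector_space "scaleC :: complex \<Rightarrow> 'a::complex_normed_vector \<Rightarrow> 'a"
  by (rule scaleC_vector_space)

text \<open>The \<open>k\<close>-th term of the Taylor series of \<open>f\<close> at the origin, read off along the line through \<open>x\<close>. It is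
meaningful for every \<open>x\<close>, also outside the ball.\<close>

definition homogeneous_part :: "nat \<Rightarrow> ('a::complex_normed_vector \<Rightarrow> complex) \<Rightarrow> 'a \<Rightarrow> complex"
  where "homogeneous_part k f x = taylor_coeff k (\<lambda>c. f (c *\<^sub>C x))"

lemma holomorphic_on_central_line:
  "Gateaux_holomorphic f \<Longrightarrow> (\<lambda>c. f (c *\<^sub>C x)) holomorphic_on line_domain 0 x"
  using Gateaux_holomorphicD[of f 0 x] by simp

lemma homogeneous_part_bound:
  assumes "Gateaux_holomorphic f" "0 < R" "R * norm x < 1"
    and "\<And>z. cmod z = R \<Longrightarrow> cmod (f (z *\<^sub>C x)) \<le> M"
  shows "cmod (homogeneous_part k f x) \<le> M / R ^ k"
  unfolding homogeneous_part_def
  by (rule taylor_coeff_bound[OF holomorphic_on_central_line])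
    (use assms cball_subset_line_domain[of 0 R x] in auto)

lemma homogeneous_part_scaleC:
  assumes "Gateaux_holomorphic f"
  shows "homogeneous_part k f (c *\<^sub>C x) = c ^ k * homogeneous_part k f x"
  unfolding homogeneous_part_def
  using taylor_coeff_dilate[OF holomorphic_on_central_line[OF assms] open_line_domain zero_in_line_domain, of k c x]
  by (simp add: scaleC_scaleC mult.commute)

lemma homogeneous_part_1_eq_line_deriv: "homogeneous_part 1 f x = line_deriv f 0 x"
  by (simp add: homogeneous_part_def taylor_coeff_def line_deriv_def)

lemma homogeneous_part_at_0:
  assumes "f 0 = 0" shows "homogeneous_part k f 0 = 0"
  using higher_deriv_const[of k 0] by (simp add: homogeneous_part_def taylor_coeff_def assms)

context
  fixes f :: "'a::complex_normed_vector \<Rightarrow> complex" and C :: real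
  assumes lip: "C-lipschitz_on (ball 0 1) f" and hol: "Gateaux_holomorphic f"
begin

text \<open>Lipschitz estimates for homogeneous parts come from Cauchy's estimates for the difference of \<open>f\<close>
along two lines, which the Lipschitz condition bounds by \<open>C * norm (x - y)\<close> on the unit circle.\<close>

lemma difference_along_lines:
  assumes "norm x < 1" "norm y < 1"
  defines "g \<equiv> \<lambda>c. f (c *\<^sub>C x) - f (c *\<^sub>C y)"
  shows "g holomorphic_on line_domain 0 x \<inter> line_domain 0 y"
    "cball 0 1 \<subseteq> line_domain 0 x \<inter> line_domain 0 y"
    "cmod z = 1 \<Longrightarrow> cmod (g z) \<le> C * norm (x - y)"
    "taylor_coeff k g = homogeneous_part k f x - homogeneous_part k f y"
proof -
  show sub: "cball 0 1 \<subseteq> line_domain 0 x \<inter> line_domain 0 y"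
    using assms(1,2) cball_subset_line_domain[of 0 1 x] cball_subset_line_domain[of 0 1 y] by simp
  have 1: "(\<lambda>c. f (c *\<^sub>C x)) holomorphic_on line_domain 0 x \<inter> line_domain 0 y"
    and 2: "(\<lambda>c. f (c *\<^sub>C y)) holomorphic_on line_domain 0 x \<inter> line_domain 0 y"
    by (auto intro: holomorphic_on_subset[OF holomorphic_on_central_line[OF hol]])
  then show "g holomorphic_on line_domain 0 x \<inter> line_domain 0 y"
    unfolding g_def by (rule holomorphic_on_diff)
  show "taylor_coeff k g = homogeneous_part k f x - homogeneous_part k f y"
    unfolding g_def homogeneous_part_def using sub
    by (intro taylor_coeff_diff[OF 1 2] open_Int open_line_domain) auto
  assume z: "cmod z = 1"
  have "dist (f (z *\<^sub>C x)) (f (z *\<^sub>C y)) \<le> C * dist (z *\<^sub>C x) (z *\<^sub>C y)"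
    using assms z by (intro lipschitz_onD[OF lip]) (auto simp: norm_scaleC)
  then show "cmod (g z) \<le> C * norm (x - y)"
    using z by (simp add: g_def dist_norm scaleC_diff_right[symmetric] norm_scaleC)
qed

lemma homogeneous_part_lipschitz: "C-lipschitz_on (ball 0 1) (homogeneous_part k f)"
proof (rule lipschitz_onI)
  fix x y :: 'a assume "x \<in> ball 0 1" "y \<in> ball 0 1"
  then have xy: "norm x < 1" "norm y < 1" by auto
  show "dist (homogeneous_part k f x) (homogeneous_part k f y) \<le> C * dist x y"
    using taylor_coeff_bound[OF difference_along_lines(1,2)[OF xy] _ difference_along_lines(3)[OF xy], of k]
    by (simp add: difference_along_lines(4)[OF xy] dist_norm)
qed (rule lipschitz_on_nonneg[OF lip])

lemma homogeneous_expansion_remainder: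
  assumes xy: "norm x < 1" "norm y < 1" and z: "cmod z < 1"
  shows "cmod ((f (z *\<^sub>C x) - f (z *\<^sub>C y)) -
      (\<Sum>k\<le>n. z ^ k * (homogeneous_part k f x - homogeneous_part k f y)))
    \<le> C * norm (x - y) * (cmod z ^ Suc n / (1 - cmod z))"
  using taylor_remainder_bound[OF difference_along_lines(1,2)[OF xy] _ difference_along_lines(3)[OF xy], of z n] z
  by (simp add: difference_along_lines(4)[OF xy] mult.commute)

text \<open>By induction on \<open>k\<close>: the homogeneous part of degree \<open>k\<close> is the limit, as \<open>\<mu> \<rightarrow> 0\<close>, of
\<open>\<mu>\<^sup>-\<^sup>k (f (\<mu> x) - \<Sum>j<k. \<mu>\<^sup>j P\<^sub>j x)\<close>. By the remainder estimate the convergence is uniform on the ball, and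
the approximants are holomorphic by the induction hypothesis.\<close>

lemma homogeneous_part_holomorphic:
  assumes f0: "f 0 = 0"
  shows "Gateaux_holomorphic (homogeneous_part k f)"
proof (induction k rule: less_induct)
  case (less k)
  show ?case
    unfolding Gateaux_holomorphic_def
  proof (intro allI)
    fix x y :: 'a
    let ?S = "line_domain x y"
    \<comment> \<open>Dilation factors tending to 0 and bounded by 1/2, which keeps the geometric factor \<open>1 / (1 - |\<mu>|)\<close> at most 2.\<close>
    define \<mu> :: "nat \<Rightarrow> complex" where "\<mu> m = of_real (inverse (real (m + 2)))" for m
    have \<mu>: "cmod (\<mu> m) = inverse (real (m + 2))" "cmod (\<mu> m) \<le> 1 / 2" "\<mu> m \<noteq> 0" for m
    proof -
      show *: "cmod (\<mu> m) = inverse (real (m + 2))" unfolding \<mu>_def norm_of_real by simp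
      show "cmod (\<mu> m) \<le> 1 / 2" unfolding * by (simp add: field_simps)
      show "\<mu> m \<noteq> 0"
      proof
        assume "\<mu> m = 0"
        with * have "inverse (real (m + 2)) = 0" by simp
        then show False by simp
      qed
    qed
    define u where "u m c = (f (\<mu> m *\<^sub>C (x + c *\<^sub>C y)) -
      (\<Sum>j<k. \<mu> m ^ j * homogeneous_part j f (x + c *\<^sub>C y))) / \<mu> m ^ k" for m c
    have close: "cmod (u m c - homogeneous_part k f (x + c *\<^sub>C y)) \<le> 2 * C * inverse (real (m + 2))"
      if c: "c \<in> ?S" for m c
    proof -
      define w where "w = x + c *\<^sub>C y"
      have w: "norm w < 1" using c by (simp add: w_def line_domain_def)
      have "cmod (f (\<mu> m *\<^sub>C w) - (\<Sum>j\<le>k. \<mu> m ^ j * homogeneous_part j f w))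
          \<le> C * norm w * (cmod (\<mu> m) ^ Suc k / (1 - cmod (\<mu> m)))"
        using homogeneous_expansion_remainder[OF w, of 0 "\<mu> m" k] \<mu>(2)[of m] f0
        by (simp add: homogeneous_part_at_0)
      also have "\<dots> \<le> C * 1 * (cmod (\<mu> m) ^ Suc k / (1 / 2))"
        using w \<mu>(2)[of m] lipschitz_on_nonneg[OF lip]
        by (intro mult_mono divide_left_mono) auto
      finally have "cmod (f (\<mu> m *\<^sub>C w) - (\<Sum>j\<le>k. \<mu> m ^ j * homogeneous_part j f w)) / cmod (\<mu> m) ^ k
          \<le> (2 * C * cmod (\<mu> m)) * cmod (\<mu> m) ^ k / cmod (\<mu> m) ^ k"
        by (intro divide_right_mono) (auto simp: mult_ac)
      also have "\<dots> = 2 * C * cmod (\<mu> m)" using \<mu>(3)[of m] by simp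
      also have "cmod (f (\<mu> m *\<^sub>C w) - (\<Sum>j\<le>k. \<mu> m ^ j * homogeneous_part j f w)) / cmod (\<mu> m) ^ k
          = cmod (u m c - homogeneous_part k f w)"
        using \<mu>(3)[of m] unfolding u_def w_def[symmetric] norm_power[symmetric] norm_divide[symmetric]
        by (simp add: lessThan_Suc_atMost[symmetric] diff_divide_distrib add_divide_distrib diff_diff_eq)
      finally show ?thesis using \<mu>(1)[of m] by (simp add: w_def)
    qed
    show "(\<lambda>c. homogeneous_part k f (x + c *\<^sub>C y)) holomorphic_on ?S"
    proof (rule holomorphic_uniform_sequence[OF open_line_domain])
      show "u m holomorphic_on ?S" for m
      proof -
        have "(\<lambda>c. f (\<mu> m *\<^sub>C x + c *\<^sub>C \<mu> m *\<^sub>C y)) holomorphic_on ?S"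
        proof (rule holomorphic_on_subset[OF Gateaux_holomorphicD[OF hol]])
          show "?S \<subseteq> line_domain (\<mu> m *\<^sub>C x) (\<mu> m *\<^sub>C y)"
          proof
            fix c assume "c \<in> ?S"
            then have "cmod (\<mu> m) * norm (x + c *\<^sub>C y) < 1"
              using \<mu>(2)[of m] mult_strict_mono[of "cmod (\<mu> m)" 1 "norm (x + c *\<^sub>C y)" 1]
              by (simp add: line_domain_def)
            moreover have "\<mu> m *\<^sub>C x + c *\<^sub>C \<mu> m *\<^sub>C y = \<mu> m *\<^sub>C (x + c *\<^sub>C y)"
              by (simp add: scaleC_add_right scaleC_scaleC mult.commute)
            ultimately show "c \<in> line_domain (\<mu> m *\<^sub>C x) (\<mu> m *\<^sub>C y)"
              by (simp add: line_domain_def norm_scaleC)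
          qed
        qed
        then have "(\<lambda>c. f (\<mu> m *\<^sub>C (x + c *\<^sub>C y))) holomorphic_on ?S"
          by (simp add: scaleC_add_right scaleC_scaleC mult.commute)
        moreover have "(\<lambda>c. \<Sum>j<k. \<mu> m ^ j * homogeneous_part j f (x + c *\<^sub>C y)) holomorphic_on ?S"
          by (intro holomorphic_on_sum holomorphic_on_mult holomorphic_on_const
              Gateaux_holomorphicD less.IH) simp
        ultimately show ?thesis
          unfolding u_def using \<mu>(3)[of m]
          by (intro holomorphic_on_divide holomorphic_on_diff holomorphic_on_const) auto
      qed
      fix c assume "c \<in> ?S"
      then obtain d where d: "0 < d" "cball c d \<subseteq> ?S"
        using open_line_domain open_contains_cball by blast
      have "uniform_limit ?S u (\<lambda>c. homogeneous_part k f (x + c *\<^sub>C y)) sequentially"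
      proof (rule uniform_limitI)
        fix e :: real assume "0 < e"
        have "(\<lambda>m. 2 * C * inverse (real (m + 2))) \<longlonglongrightarrow> 2 * C * 0"
          by (intro tendsto_mult tendsto_const LIMSEQ_ignore_initial_segment[OF lim_inverse_n])
        then have "\<forall>\<^sub>F m in sequentially. 2 * C * inverse (real (m + 2)) < e"
          using \<open>0 < e\<close> by (intro order_tendstoD(2)[where y = "2 * C * 0"]) auto
        then show "\<forall>\<^sub>F m in sequentially. \<forall>c\<in>?S. dist (u m c) (homogeneous_part k f (x + c *\<^sub>C y)) < e"
        proof eventually_elim
          case (elim m)
          show ?case
          proof
            fix c assume "c \<in> ?S"
            from close[OF this, of m] elim show "dist (u m c) (homogeneous_part k f (x + c *\<^sub>C y)) < e"
              unfolding dist_norm by (rule le_less_trans)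
          qed
        qed
      qed
      then show "\<exists>d>0. cball c d \<subseteq> ?S \<and>
          uniform_limit (cball c d) u (\<lambda>c. homogeneous_part k f (x + c *\<^sub>C y)) sequentially"
        using d uniform_limit_on_subset by blast
    qed
  qed
qed

text \<open>Homogeneity transports the Lipschitz bound on the ball, used at the point \<open>x / (2 * norm x)\<close>, to the
whole space.\<close>

lemma homogeneous_part_growth:
  assumes f0: "f 0 = 0"
  shows "cmod (homogeneous_part k f x) \<le> C * (2 * norm x) ^ k"
proof (cases "x = 0")
  case True
  then show ?thesis using homogeneous_part_at_0[of f k, OF f0] lipschitz_on_nonneg[OF lip] by simp
next
  case False
  define s :: complex where "s = of_real (2 * norm x)"
  define u where "u = inverse s *\<^sub>C x"
  have u: "norm u = 1 / 2" "x = s *\<^sub>C u"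
    using False by (auto simp: u_def s_def norm_scaleC norm_inverse norm_mult scaleC_scaleC)
  have "cmod (homogeneous_part k f u) \<le> C * norm u"
    using lipschitz_onD[OF homogeneous_part_lipschitz, of u 0 k] homogeneous_part_at_0[of f k, OF f0]
    by (simp add: dist_norm u(1))
  also have "\<dots> \<le> C" using lipschitz_on_nonneg[OF lip] by (simp add: u(1))
  finally have "(2 * norm x) ^ k * cmod (homogeneous_part k f u) \<le> (2 * norm x) ^ k * C"
    by (intro mult_left_mono) auto
  then show ?thesis
    using homogeneous_part_scaleC[OF hol, of k s u] unfolding u(2)[symmetric]
    by (simp add: norm_mult norm_power s_def mult.commute)
qed

text \<open>Homogeneity shrinks any disc on any line into the unit ball, where holomorphy is known.\<close>

lemma homogeneous_part_entire_on_lines: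
  assumes f0: "f 0 = 0"
  shows "(\<lambda>c. homogeneous_part k f (x + c *\<^sub>C y)) holomorphic_on UNIV"
proof -
  have "(\<lambda>c. homogeneous_part k f (x + c *\<^sub>C y)) holomorphic_on ball 0 (real n)" for n
  proof -
    define R where "R = norm x + real n * norm y + 1"
    have R: "R > 0" by (simp add: R_def add_nonneg_pos)
    define s :: complex where "s = of_real R"
    have s: "s \<noteq> 0" "cmod s = R" using R by (auto simp: s_def)
    have "norm (inverse s *\<^sub>C x) + real n * norm (inverse s *\<^sub>C y) = (R - 1) / R"
      using s by (simp add: norm_scaleC norm_inverse R_def divide_inverse algebra_simps)
    then have "cball 0 (real n) \<subseteq> line_domain (inverse s *\<^sub>C x) (inverse s *\<^sub>C y)"
      using R by (intro cball_subset_line_domain) auto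
    then have "(\<lambda>c. s ^ k * homogeneous_part k f (inverse s *\<^sub>C x + c *\<^sub>C inverse s *\<^sub>C y))
        holomorphic_on ball 0 (real n)"
      using ball_subset_cball
      by (intro holomorphic_intros
          holomorphic_on_subset[OF Gateaux_holomorphicD[OF homogeneous_part_holomorphic[OF f0]]]) blast
    moreover have "s ^ k * homogeneous_part k f (inverse s *\<^sub>C x + c *\<^sub>C inverse s *\<^sub>C y)
        = homogeneous_part k f (x + c *\<^sub>C y)" for c
      using s unfolding homogeneous_part_scaleC[OF hol, symmetric]
      by (simp add: scaleC_add_right scaleC_scaleC mult.left_commute[of s c])
    ultimately show ?thesis by simp
  qed
  then have "(\<lambda>c. homogeneous_part k f (x + c *\<^sub>C y)) holomorphic_on (\<Union>n. ball 0 (real n))"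
    by (intro holomorphic_on_UN_open) auto
  moreover have "(\<Union>n. ball (0::complex) (real n)) = UNIV"
    using reals_Archimedean2 by auto
  ultimately show ?thesis by simp
qed

end

definition polynomial_on_lines :: "nat \<Rightarrow> ('a::complex_normed_vector \<Rightarrow> complex) \<Rightarrow> bool"
  where "polynomial_on_lines n h \<longleftrightarrow> (\<forall>x y. \<exists>a. \<forall>c. h (x + c *\<^sub>C y) = (\<Sum>j\<le>n. a j * c ^ j))"

text \<open>An entire function of growth \<open>|c| ^ k\<close> is a polynomial of degree at most \<open>k\<close>, by Liouville's theorem.\<close>

lemma homogeneous_part_polynomial_on_lines:
  assumes lip: "C-lipschitz_on (ball 0 1) f" and hol: "Gateaux_holomorphic f" and f0: "f 0 = 0"
  shows "polynomial_on_lines k (homogeneous_part k f)"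
  unfolding polynomial_on_lines_def
proof (intro allI)
  fix x y :: 'a
  let ?g = "\<lambda>c. homogeneous_part k f (x + c *\<^sub>C y)"
  have bound: "cmod (?g c) \<le> C * (2 * (norm x + norm y)) ^ k * cmod c ^ k" if "1 \<le> cmod c" for c
  proof -
    have "norm (x + c *\<^sub>C y) \<le> norm x * cmod c + cmod c * norm y"
      using norm_triangle_ineq[of x "c *\<^sub>C y"] mult_left_mono[OF that, of "norm x"]
      by (simp add: norm_scaleC)
    then have "(2 * norm (x + c *\<^sub>C y)) ^ k \<le> (2 * (norm x + norm y) * cmod c) ^ k"
      by (intro power_mono) (auto simp: algebra_simps)
    then have "C * (2 * norm (x + c *\<^sub>C y)) ^ k \<le> C * ((2 * (norm x + norm y)) ^ k * cmod c ^ k)"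
      using lipschitz_on_nonneg[OF lip] by (intro mult_left_mono) (auto simp: power_mult_distrib)
    then show ?thesis
      using homogeneous_part_growth[OF lip hol f0, of k "x + c *\<^sub>C y"] by (simp add: mult.assoc)
  qed
  show "\<exists>a. \<forall>c. ?g c = (\<Sum>j\<le>k. a j * c ^ j)"
    using Liouville_polynomial[OF homogeneous_part_entire_on_lines[OF lip hol f0] bound] by meson
qed

lemma polynomial_zero_at_integers:
  fixes a :: "nat \<Rightarrow> complex"
  assumes "\<And>i. i \<le> n \<Longrightarrow> (\<Sum>j\<le>n. a j * of_nat i ^ j) = 0"
  shows "(\<Sum>j\<le>n. a j * c ^ j) = 0"
proof (cases "\<exists>j\<le>n. a j \<noteq> 0")
  case True
  then have roots: "finite {z. (\<Sum>j\<le>n. a j * z ^ j) = 0}" "card {z. (\<Sum>j\<le>n. a j * z ^ j) = 0} \<le> n"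
    using polyfun_rootbound[OF True] by auto
  have "of_nat ` {..n} \<subseteq> {z. (\<Sum>j\<le>n. a j * z ^ j) = 0}" using assms by auto
  then have "card (of_nat ` {..n} :: complex set) \<le> n"
    using roots card_mono order_trans by blast
  then show ?thesis by (simp add: card_image inj_on_def)
qed auto

text \<open>The grid consists of the combinations of the elements of \<open>B\<close> with integer coefficients between \<open>0\<close> and
\<open>n\<close>: a polynomial of degree \<open>n\<close> in one variable is zero if it vanishes at \<open>0, \<dots>, n\<close>, and this is applied
in one coordinate direction at a time. Hence such functions form a finite-dimensional space over a
finite-dimensional domain, without any mention of polynomials in several variables.\<close>

lemma polynomial_on_lines_determined_by_grid:
  fixes B :: "'a::complex_normed_vector set"
  assumes "finite B"
  shows "\<exists>G. finite G \<and> (\<forall>h. polynomial_on_lines n h \<longrightarrow> (\<forall>g\<in>G. h g = 0) \<longrightarrow>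
    (\<forall>x\<in>module.span scaleC B. h x = 0))"
  using assms
proof (induction B rule: finite_induct)
  case empty
  show ?case by (rule exI[of _ "{0}"]) simp
next
  case (insert b B)
  then obtain G where G: "finite G" "\<And>h x. polynomial_on_lines n h \<Longrightarrow> (\<And>g. g \<in> G \<Longrightarrow> h g = 0) \<Longrightarrow>
      x \<in> cvs.span B \<Longrightarrow> h x = 0" by blast
  define G' where "G' = (\<Union>i\<le>n. (\<lambda>g. g + of_nat i *\<^sub>C b) ` G)"
  have "h x = 0" if h: "polynomial_on_lines n h" "\<And>g. g \<in> G' \<Longrightarrow> h g = 0"
    and x: "x \<in> cvs.span (insert b B)" for h x
  proof -
    obtain c where c: "x - c *\<^sub>C b \<in> cvs.span B" using x cvs.span_breakdown_eq by blast
    have zero: "h ((x - c *\<^sub>C b) + of_nat i *\<^sub>C b) = 0" if i: "i \<le> n" for i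
    proof (rule G(2)[OF _ _ c])
      show "polynomial_on_lines n (\<lambda>z. h (z + of_nat i *\<^sub>C b))"
        unfolding polynomial_on_lines_def
      proof (intro allI)
        fix y z
        have eq: "y + c *\<^sub>C z + of_nat i *\<^sub>C b = (y + of_nat i *\<^sub>C b) + c *\<^sub>C z" for c
          by (simp add: algebra_simps)
        show "\<exists>a. \<forall>c. h (y + c *\<^sub>C z + of_nat i *\<^sub>C b) = (\<Sum>j\<le>n. a j * c ^ j)"
          using h(1)[unfolded polynomial_on_lines_def, rule_format, of "y + of_nat i *\<^sub>C b" z]
          unfolding eq .
      qed
      show "h (g + of_nat i *\<^sub>C b) = 0" if "g \<in> G" for g
        using that i by (intro h(2)) (auto simp: G'_def)
    qed
    obtain a where a: "\<And>t. h ((x - c *\<^sub>C b) + t *\<^sub>C b) = (\<Sum>j\<le>n. a j * t ^ j)"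
      using h(1) unfolding polynomial_on_lines_def by blast
    have "(\<Sum>j\<le>n. a j * c ^ j) = 0"
    proof (rule polynomial_zero_at_integers)
      show "(\<Sum>j\<le>n. a j * of_nat i ^ j) = 0" if "i \<le> n" for i
        using zero[OF that] a[of "of_nat i"] by simp
    qed
    then show ?thesis using a[of c] by simp
  qed
  moreover have "finite G'" using G(1) by (simp add: G'_def)
  ultimately show ?case by blast
qed

section \<open>The space of holomorphic Lipschitz functions and its predual\<close>

lemma hl_holomorphic: "Gateaux_holomorphic (hl_apply f)"
  using hl_apply[of f] by (auto intro: Frechet_imp_Gateaux_holomorphic)

lemma hl_zero [simp]: "hl_apply f 0 = 0"
  using hl_apply[of f] by auto

lemma hl_add: "hl_apply (f + g) x = hl_apply f x + hl_apply g x"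
  by (simp add: plus_hol_lip.rep_eq)

lemma hl_scaleC: "hl_apply (c *\<^sub>C f) x = c * hl_apply f x"
  by (simp add: scaleC_hol_lip.rep_eq)

lemma complex_linear_evaluation: "complex_linear (\<lambda>f. hl_apply f x)"
  by (simp add: complex_linear_def hl_add hl_scaleC)

lemma hl_diff: "hl_apply (f - g) x = hl_apply f x - hl_apply g x"
  using complex_linear_diff[OF complex_linear_evaluation] .

lemma hl_eqI: "(\<And>x. norm x < 1 \<Longrightarrow> hl_apply f x = hl_apply g x) \<Longrightarrow> f = g"
  using hl_apply[of f] hl_apply[of g] unfolding hl_apply_inject[symmetric] fun_eq_iff by force

lemma hl_bound: "norm x < 1 \<Longrightarrow> cmod (hl_apply f x) \<le> norm f * norm x"
  using lipschitz_onD[OF hl_lipschitz, of x 0 f] by (simp add: dist_norm)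

text \<open>The value outside the ball is forced to be \<open>0\<close>, as in the representatives that make up the type.\<close>

definition hol_lip_of :: "('a::complex_normed_vector \<Rightarrow> complex) \<Rightarrow> 'a hol_lip"
  where "hol_lip_of h = Abs_hol_lip (\<lambda>x. if x \<in> ball 0 1 then h x else 0)"

lemma hol_lip_of:
  assumes lip: "C-lipschitz_on (ball 0 1) h" and hol: "Gateaux_holomorphic h" and 0: "h 0 = 0"
  shows "norm x < 1 \<Longrightarrow> hl_apply (hol_lip_of h) x = h x" "norm (hol_lip_of h) \<le> C"
proof -
  let ?h = "\<lambda>x. if x \<in> ball 0 1 then h x else 0"
  have lip': "C-lipschitz_on (ball 0 1) ?h"
    using lip by (rule lipschitz_on_transform) auto
  have "Gateaux_holomorphic ?h"
    unfolding Gateaux_holomorphic_def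
  proof (intro allI)
    fix x y :: 'a
    show "(\<lambda>c. ?h (x + c *\<^sub>C y)) holomorphic_on line_domain x y"
      using Gateaux_holomorphicD[OF hol, of x y] 
      by (rule holomorphic_transform) (simp add: line_domain_def)
  qed
  then have "holomorphic_on_unit_ball ?h"
    by (rule Gateaux_lipschitz_imp_Frechet_holomorphic[OF lip'])
  then have *: "hl_apply (hol_lip_of h) = ?h"
    unfolding hol_lip_of_def using lip' 0 by (intro Abs_hol_lip_inverse) auto
  then show "norm x < 1 \<Longrightarrow> hl_apply (hol_lip_of h) x = h x" by simp
  show "norm (hol_lip_of h) \<le> C" using lip' by (intro norm_hl_le) (simp add: *)
qed

lemma hol_lip_of_functional:
  assumes F: "complex_linear F" "\<And>y. cmod (F y) \<le> norm y"
  shows "norm x < 1 \<Longrightarrow> hl_apply (hol_lip_of F) x = F x" "norm (hol_lip_of F) \<le> 1"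
proof -
  have 1: "1-lipschitz_on (ball 0 1) F"
    by (intro lipschitz_onI) (simp_all add: dist_norm complex_linear_diff[OF F(1), symmetric] F(2))
  have "(\<lambda>c. F (x + c *\<^sub>C y)) = (\<lambda>c. F x + c * F y)" for x y
    using F(1) by (simp add: complex_linear_def)
  then have 2: "Gateaux_holomorphic F"
    unfolding Gateaux_holomorphic_def by (auto intro!: holomorphic_intros)
  have 3: "F 0 = 0" using F(2)[of 0] by simp
  show "norm x < 1 \<Longrightarrow> hl_apply (hol_lip_of F) x = F x" "norm (hol_lip_of F) \<le> 1"
    using hol_lip_of[OF 1 2 3] by auto
qed

text \<open>Continuity at the origin of a functional on the unit ball of the function space, for the
compact-open topology. By linearity this is continuity everywhere on that ball, and unlike the
topological formulation it is easy to check and to use.\<close>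

definition small_on_compacts :: "('a::complex_normed_vector hol_lip \<Rightarrow> complex) \<Rightarrow> bool"
  where "small_on_compacts \<phi> \<longleftrightarrow> (\<forall>\<epsilon>>0. \<exists>K \<delta>. compact K \<and> K \<subseteq> ball 0 1 \<and> 0 < \<delta> \<and>
    (\<forall>f. norm f \<le> 1 \<longrightarrow> (\<forall>x\<in>K. cmod (hl_apply f x) < \<delta>) \<longrightarrow> cmod (\<phi> f) < \<epsilon>))"

lemma small_on_compactsD:
  assumes "small_on_compacts \<phi>" "0 < \<epsilon>"
  obtains K \<delta> where "compact K" "K \<subseteq> ball 0 1" "0 < \<delta>"
    "\<And>f. norm f \<le> 1 \<Longrightarrow> (\<And>x. x \<in> K \<Longrightarrow> cmod (hl_apply f x) < \<delta>) \<Longrightarrow> cmod (\<phi> f) < \<epsilon>"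
  using assms unfolding small_on_compacts_def by meson

lemma topspace_tau0 [simp]: "topspace (tau0 :: 'a::complex_normed_vector hol_lip topology) = UNIV"
proof -
  have "UNIV = {g :: 'a hol_lip. \<forall>x\<in>{}. cmod (hl_apply g x - hl_apply 0 x) < (1::real)}" by simp
  then have "UNIV \<in> {{g :: 'a hol_lip. \<forall>x\<in>K. cmod (hl_apply g x - hl_apply f x) < \<epsilon>} | f K \<epsilon>.
      compact K \<and> K \<subseteq> ball 0 1 \<and> 0 < \<epsilon>}"
    using compact_empty zero_less_one by blast
  then show ?thesis unfolding tau0_def topology_generated_by_topspace by blast
qed

lemma openin_tau0_basic:
  assumes "compact K" "K \<subseteq> ball 0 1" "0 < \<epsilon>"
  shows "openin tau0 {g. \<forall>x\<in>K. cmod (hl_apply g x - hl_apply f x) < \<epsilon>}"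
  unfolding tau0_def using assms by (intro topology_generated_by_Basis) blast

text \<open>The generating sets are centred at arbitrary functions. Around each of its points \<open>g\<close> such a set
contains one that is centred at \<open>g\<close>, because the supremum of \<open>|g - f|\<close> over a compact set is attained and
leaves a positive margin.\<close>

lemma tau0_neighbourhood:
  fixes g :: "'a::complex_normed_vector hol_lip"
  assumes "openin tau0 W" "g \<in> W"
  shows "\<exists>K \<delta>. compact K \<and> K \<subseteq> ball 0 1 \<and> 0 < \<delta> \<and>
    {f. \<forall>x\<in>K. cmod (hl_apply f x - hl_apply g x) < \<delta>} \<subseteq> W"
proof -
  have "generate_topology_on {{g. \<forall>x\<in>K. cmod (hl_apply g x - hl_apply f x) < \<epsilon>} | f K \<epsilon>.
      compact K \<and> K \<subseteq> ball (0::'a) 1 \<and> 0 < \<epsilon>} W"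
    using assms(1) unfolding tau0_def openin_topology_generated_by_iff .
  then show ?thesis using assms(2)
  proof (induction arbitrary: g rule: generate_topology_on.induct)
    case Empty
    then show ?case by simp
  next
    case (Int U V)
    obtain K1 \<delta>1 where 1: "compact K1" "K1 \<subseteq> ball 0 1" "0 < \<delta>1"
      "{f. \<forall>x\<in>K1. cmod (hl_apply f x - hl_apply g x) < \<delta>1} \<subseteq> U"
      using Int.IH(1)[of g] Int.prems by auto
    obtain K2 \<delta>2 where 2: "compact K2" "K2 \<subseteq> ball 0 1" "0 < \<delta>2"
      "{f. \<forall>x\<in>K2. cmod (hl_apply f x - hl_apply g x) < \<delta>2} \<subseteq> V"
      using Int.IH(2)[of g] Int.prems by auto
    show ?case
      using 1 2 by (intro exI[of _ "K1 \<union> K2"] exI[of _ "min \<delta>1 \<delta>2"]) (auto simp: compact_Un)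
  next
    case (UN \<U>)
    then obtain U where U: "U \<in> \<U>" "g \<in> U" by blast
    from UN.IH[OF this] U(1) show ?case by (meson Union_upper order_trans)
  next
    case (Basis U)
    then obtain f K \<epsilon> where U: "U = {g. \<forall>x\<in>K. cmod (hl_apply g x - hl_apply f x) < \<epsilon>}"
      and K: "compact K" "K \<subseteq> ball 0 1" "0 < \<epsilon>" by blast
    show ?case
    proof (cases "K = {}")
      case True
      then show ?thesis using K by (intro exI[of _ "{}"] exI[of _ 1]) (simp add: U)
    next
      case False
      have "continuous_on K (\<lambda>x. cmod (hl_apply g x - hl_apply f x))"
        using K(2) continuous_on_subset[OF lipschitz_on_continuous_on[OF hl_lipschitz]]
        by (intro continuous_intros) auto
      then obtain x0 where x0: "x0 \<in> K"
        "\<And>x. x \<in> K \<Longrightarrow> cmod (hl_apply g x - hl_apply f x) \<le> cmod (hl_apply g x0 - hl_apply f x0)"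
        using continuous_attains_sup[OF K(1) False, of "\<lambda>x. cmod (hl_apply g x - hl_apply f x)"] by blast
      define \<delta> where "\<delta> = \<epsilon> - cmod (hl_apply g x0 - hl_apply f x0)"
      have "0 < \<delta>" using Basis.prems x0(1) by (simp add: U \<delta>_def)
      moreover have "h \<in> U" if h: "\<forall>x\<in>K. cmod (hl_apply h x - hl_apply g x) < \<delta>" for h
      proof -
        have "cmod (hl_apply h x - hl_apply f x) < \<epsilon>" if "x \<in> K" for x
          using x0(2)[OF that] bspec[OF h that]
            norm_triangle_ineq[of "hl_apply h x - hl_apply g x" "hl_apply g x - hl_apply f x"]
          by (simp add: \<delta>_def)
        then show ?thesis by (simp add: U)
      qed
      ultimately show ?thesis using K(1,2) by blast
    qed
  qed
qed

theorem tau0_continuous_iff_small_on_compacts: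
  assumes lin: "complex_linear \<phi>"
  shows "continuous_map (subtopology tau0 {f. norm f \<le> 1}) euclidean \<phi> \<longleftrightarrow> small_on_compacts \<phi>"
proof
  assume cont: "continuous_map (subtopology tau0 {f. norm f \<le> 1}) euclidean \<phi>"
  show "small_on_compacts \<phi>"
    unfolding small_on_compacts_def
  proof (intro allI impI)
    fix \<epsilon> :: real assume \<epsilon>: "0 < \<epsilon>"
    have "openin (subtopology tau0 {f. norm f \<le> 1}) {f \<in> topspace (subtopology tau0 {f. norm f \<le> 1}). \<phi> f \<in> ball 0 \<epsilon>}"
      using cont by (rule openin_continuous_map_preimage) simp
    then obtain W where W: "openin tau0 W"
      and "{f \<in> topspace (subtopology tau0 {f. norm f \<le> 1}). \<phi> f \<in> ball 0 \<epsilon>} = W \<inter> {f. norm f \<le> 1}"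
      unfolding openin_subtopology by blast
    then have W_iff: "f \<in> W \<longleftrightarrow> cmod (\<phi> f) < \<epsilon>" if "norm f \<le> 1" for f
      using that by (simp add: set_eq_iff) blast
    have "\<phi> 0 = 0" using complex_linear_diff[OF lin, of 0 0] by simp
    then have "0 \<in> W" using W_iff \<epsilon> by simp
    from tau0_neighbourhood[OF W this] obtain K \<delta> where
      K: "compact K" "K \<subseteq> ball 0 1" "0 < \<delta>" "{f. \<forall>x\<in>K. cmod (hl_apply f x) < \<delta>} \<subseteq> W"
      by (auto simp: zero_hol_lip.rep_eq)
    then have "\<forall>f. norm f \<le> 1 \<longrightarrow> (\<forall>x\<in>K. cmod (hl_apply f x) < \<delta>) \<longrightarrow> cmod (\<phi> f) < \<epsilon>"
      using W_iff by blast
    then show "\<exists>K \<delta>. compact K \<and> K \<subseteq> ball 0 1 \<and> 0 < \<delta> \<and>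
      (\<forall>f. norm f \<le> 1 \<longrightarrow> (\<forall>x\<in>K. cmod (hl_apply f x) < \<delta>) \<longrightarrow> cmod (\<phi> f) < \<epsilon>)"
      using K by blast
  qed
next
  assume small: "small_on_compacts \<phi>"
  show "continuous_map (subtopology tau0 {f. norm f \<le> 1}) euclidean \<phi>"
    unfolding continuous_map_def
  proof (intro conjI allI impI)
    fix U :: "complex set" assume "openin euclidean U"
    then have U: "open U" by simp
    show "openin (subtopology tau0 {f. norm f \<le> 1}) {f \<in> topspace (subtopology tau0 {f. norm f \<le> 1}). \<phi> f \<in> U}"
    proof (subst openin_subopen, intro ballI)
      fix f assume "f \<in> {f \<in> topspace (subtopology tau0 {f. norm f \<le> 1}). \<phi> f \<in> U}"
      then have f: "norm f \<le> 1" "\<phi> f \<in> U" by auto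
      obtain \<epsilon> where \<epsilon>: "0 < \<epsilon>" "ball (\<phi> f) \<epsilon> \<subseteq> U" using U f(2) open_contains_ball by blast
      obtain K \<delta> where K: "compact K" "K \<subseteq> ball 0 1" "0 < \<delta>"
        and le: "\<And>f. norm f \<le> 1 \<Longrightarrow> (\<And>x. x \<in> K \<Longrightarrow> cmod (hl_apply f x) < \<delta>) \<Longrightarrow> cmod (\<phi> f) < \<epsilon> / 2"
        using small_on_compactsD[OF small, of "\<epsilon> / 2"] \<epsilon>(1) by (metis half_gt_zero)
      let ?N = "{g. \<forall>x\<in>K. cmod (hl_apply g x - hl_apply f x) < 2 * \<delta>}"
      have "\<phi> g \<in> U" if g: "norm g \<le> 1" "g \<in> ?N" for g
      proof -
        \<comment> \<open>The difference of two functions of norm at most 1 has norm at most 2; halving it returns to the unit ball.\<close>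
        let ?h = "(1/2) *\<^sub>C (g - f)"
        have "cmod (\<phi> ?h) < \<epsilon> / 2"
        proof (rule le)
          show "norm ?h \<le> 1" using g(1) f(1) norm_triangle_ineq4[of g f] by (simp add: norm_scaleC)
          show "cmod (hl_apply ?h x) < \<delta>" if "x \<in> K" for x
          proof -
            have "cmod (hl_apply g x - hl_apply f x) < 2 * \<delta>" using g(2) that by blast
            then show ?thesis by (simp add: hl_scaleC hl_diff norm_divide)
          qed
        qed
        also have "\<phi> ?h = (\<phi> g - \<phi> f) / 2"
          using lin complex_linear_diff[OF lin, of g f] unfolding complex_linear_def by simp
        finally show ?thesis using \<epsilon>(2) by (auto simp: dist_norm norm_divide norm_minus_commute)
      qed
      then show "\<exists>V. openin (subtopology tau0 {f. norm f \<le> 1}) V \<and> f \<in> V \<and>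
          V \<subseteq> {f \<in> topspace (subtopology tau0 {f. norm f \<le> 1}). \<phi> f \<in> U}"
        using f(1) K(3) openin_tau0_basic[OF K(1,2), of "2 * \<delta>" f]
        by (intro exI[of _ "?N \<inter> {f. norm f \<le> 1}"]) (auto simp: openin_subtopology)
    qed
  qed simp
qed

lemma G0_functional_linear: "complex_linear (blinfun_apply (G0_functional \<phi>))"
  using G0_functional[of \<phi>] by (auto simp: G0_set_def intro: bounded_clinearD)

lemma G0_functional_small_on_compacts: "small_on_compacts (blinfun_apply (G0_functional \<phi>))"
  using G0_functional[of \<phi>] tau0_continuous_iff_small_on_compacts[OF G0_functional_linear]
  by (auto simp: G0_set_def)

lemma G0_functional_bound: "cmod (blinfun_apply (G0_functional \<phi>) f) \<le> norm \<phi> * norm f"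
  unfolding norm_G0.rep_eq by (rule norm_blinfun)

lemma norm_G0_le:
  "0 \<le> C \<Longrightarrow> (\<And>f. cmod (blinfun_apply (G0_functional \<phi>) f) \<le> C * norm f) \<Longrightarrow> norm \<phi> \<le> C"
  unfolding norm_G0.rep_eq by (rule norm_blinfun_bound)

lemma norm_G0_le_unit_ball:
  assumes "0 \<le> C" "\<And>f. norm f \<le> 1 \<Longrightarrow> cmod (blinfun_apply (G0_functional \<phi>) f) \<le> C"
  shows "norm \<phi> \<le> C"
proof (rule norm_G0_le[OF assms(1)])
  fix f
  show "cmod (blinfun_apply (G0_functional \<phi>) f) \<le> C * norm f"
  proof (cases "f = 0")
    case False
    have "cmod (blinfun_apply (G0_functional \<phi>) (inverse (norm f) *\<^sub>R f)) \<le> C"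
      using False by (intro assms) simp
    then show ?thesis
      using False by (simp add: blinfun.scaleR_right divide_simps mult.commute)
  qed simp
qed

lemma G0_eqI: "(\<And>f. blinfun_apply (G0_functional \<phi>) f = blinfun_apply (G0_functional \<psi>) f) \<Longrightarrow> \<phi> = \<psi>"
  using G0_functional_inject blinfun_eqI by metis

definition G0_of :: "('a::complex_normed_vector hol_lip \<Rightarrow> complex) \<Rightarrow> 'a G0"
  where "G0_of \<phi> = Abs_G0 (Blinfun \<phi>)"

lemma G0_of:
  assumes "complex_linear \<phi>" "\<And>f. cmod (\<phi> f) \<le> C * norm f" "small_on_compacts \<phi>"
  shows "blinfun_apply (G0_functional (G0_of \<phi>)) = \<phi>"
proof -
  have bc: "bounded_clinear \<phi>" using assms(1,2) by (rule bounded_clinearI)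
  then have B: "blinfun_apply (Blinfun \<phi>) = \<phi>"
    by (simp add: bounded_linear_Blinfun_apply bounded_clinear_def)
  have "Blinfun \<phi> \<in> G0_set"
    using bc assms(3) tau0_continuous_iff_small_on_compacts[OF assms(1)] by (simp add: G0_set_def B)
  then show ?thesis by (simp add: G0_of_def Abs_G0_inverse B)
qed

lemma G0_arith:
  "blinfun_apply (G0_functional (\<phi> + \<psi>)) f = blinfun_apply (G0_functional \<phi>) f + blinfun_apply (G0_functional \<psi>) f"
  "blinfun_apply (G0_functional (\<phi> - \<psi>)) f = blinfun_apply (G0_functional \<phi>) f - blinfun_apply (G0_functional \<psi>) f"
  "blinfun_apply (G0_functional (c *\<^sub>C \<phi>)) f = c * blinfun_apply (G0_functional \<phi>) f"
  by (simp_all add: plus_G0.rep_eq minus_G0.rep_eq scaleC_G0.rep_eq blinfun.add_left blinfun.diff_left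
      scaleC_blinfun.rep_eq)

lemma G0_sum: "blinfun_apply (G0_functional (\<Sum>i\<in>I. \<phi> i)) f = (\<Sum>i\<in>I. blinfun_apply (G0_functional (\<phi> i)) f)"
  by (induction I rule: infinite_finite_induct) (simp_all add: G0_arith zero_G0.rep_eq)

lemma homogeneous_part_hl_linear: "complex_linear (\<lambda>f. homogeneous_part k (hl_apply f) x)"
  unfolding complex_linear_def homogeneous_part_def hl_add hl_scaleC scaleC_complex_def
  by (intro conjI allI taylor_coeff_add[where S = "line_domain 0 x"] taylor_coeff_cmult[where S = "line_domain 0 x"]
      holomorphic_on_central_line hl_holomorphic open_line_domain zero_in_line_domain) simp_all

text \<open>For \<open>k = 1\<close> this is the derivative at the origin in direction \<open>x\<close>, the canonical isometric embedding of
the space into the predual; the finite rank operators constructed below have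
their ranges in the span of finitely many of these functionals, of various degrees \<open>k\<close>.\<close>

definition taylor_functional :: "nat \<Rightarrow> 'a::complex_normed_vector \<Rightarrow> 'a G0"
  where "taylor_functional k x = G0_of (\<lambda>f. homogeneous_part k (hl_apply f) x)"

lemma taylor_functional_apply:
  "blinfun_apply (G0_functional (taylor_functional k x)) f = homogeneous_part k (hl_apply f) x"
proof -
  have "small_on_compacts (\<lambda>f. homogeneous_part k (hl_apply f) x)"
    unfolding small_on_compacts_def
  proof (intro allI impI)
    fix \<epsilon> :: real assume \<epsilon>: "0 < \<epsilon>"
    define R where "R = 1 / (norm x + 1)"
    have R: "0 < R" "R * norm x < 1" by (auto simp: R_def add_nonneg_pos divide_simps)
    let ?K = "(\<lambda>z. z *\<^sub>C x) ` sphere 0 R"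
    have "compact ?K" by (intro compact_continuous_image continuous_intros) auto
    moreover have "?K \<subseteq> ball 0 1" using R by (auto simp: norm_scaleC)
    moreover have "cmod (homogeneous_part k (hl_apply f) x) < \<epsilon>"
      if "\<forall>y\<in>?K. cmod (hl_apply f y) < \<epsilon> * R ^ k / 2" for f
    proof -
      have "cmod (homogeneous_part k (hl_apply f) x) \<le> (\<epsilon> * R ^ k / 2) / R ^ k"
        using that by (intro homogeneous_part_bound[OF hl_holomorphic R]) (auto intro: less_imp_le)
      then show ?thesis using R \<epsilon> by simp
    qed
    ultimately show "\<exists>K \<delta>. compact K \<and> K \<subseteq> ball 0 1 \<and> 0 < \<delta> \<and> (\<forall>f. norm f \<le> 1 \<longrightarrow>
        (\<forall>x\<in>K. cmod (hl_apply f x) < \<delta>) \<longrightarrow> cmod (homogeneous_part k (hl_apply f) x) < \<epsilon>)"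
      using R \<epsilon> by (intro exI[of _ ?K] exI[of _ "\<epsilon> * R ^ k / 2"]) auto
  qed
  moreover have "cmod (homogeneous_part k (hl_apply f) x) \<le> (2 * norm x) ^ k * norm f" for f
    using homogeneous_part_growth[OF hl_lipschitz hl_holomorphic hl_zero, of k f x]
    by (simp add: mult.commute)
  ultimately show ?thesis
    unfolding taylor_functional_def by (subst G0_of[OF homogeneous_part_hl_linear]) auto
qed

section \<open>Lifting approximations from the space to the predual\<close>

text \<open>The Taylor polynomial of degree \<open>n\<close> of the dilate \<open>x \<mapsto> f (r x)\<close>, composed with \<open>T\<close>.\<close>

definition truncated_dilation :: "nat \<Rightarrow> real \<Rightarrow> ('a \<Rightarrow> 'a) \<Rightarrow> ('a::complex_normed_vector \<Rightarrow> complex) \<Rightarrow> 'a \<Rightarrow> complex"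
  where "truncated_dilation n r T f x = (\<Sum>k\<le>n. of_real r ^ k * homogeneous_part k f (T x))"

definition truncated_dilation_op :: "nat \<Rightarrow> real \<Rightarrow> ('a \<Rightarrow> 'a) \<Rightarrow> 'a::complex_normed_vector hol_lip \<Rightarrow> 'a hol_lip"
  where "truncated_dilation_op n r T f = hol_lip_of (truncated_dilation n r T (hl_apply f))"

lemma bounded_clinear_norm_le:
  assumes "bounded_clinear T" "onorm T \<le> 1"
  shows "norm (T x) \<le> norm x"
  using onorm[of T x] assms mult_right_mono[of "onorm T" 1 "norm x"] by (simp add: bounded_clinear_def)

text \<open>The condition on \<open>n\<close> bounds the Lipschitz constant of the discarded Taylor tail of the dilate by
\<open>(1 - r) L(f)\<close>. As dilation by \<open>r\<close> has already reduced the Lipschitz constant to \<open>r L(f)\<close>, the truncated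
series has Lipschitz constant at most \<open>L(f)\<close>: truncation costs no more than dilation has gained.\<close>

locale finite_rank_dilation =
  fixes T :: "'a::complex_normed_vector \<Rightarrow> 'a" and r :: real and n :: nat
  assumes T_bounded: "bounded_clinear T" and T_norm: "onorm T \<le> 1" and T_finite: "finite_rank T"
    and r: "0 < r" "r < 1" and n: "r ^ Suc n / (1 - r) \<le> 1 - r"
begin

abbreviation q :: "('a \<Rightarrow> complex) \<Rightarrow> 'a \<Rightarrow> complex" where "q \<equiv> truncated_dilation n r T"
abbreviation Q :: "'a hol_lip \<Rightarrow> 'a hol_lip" where "Q \<equiv> truncated_dilation_op n r T"

lemma T_linear: "complex_linear T" using T_bounded by (rule bounded_clinearD)

lemma T_le: "norm (T x) \<le> norm x" using T_bounded T_norm by (rule bounded_clinear_norm_le)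

lemma T_zero: "T 0 = 0" using T_le[of 0] by simp

lemma q_zero: "q (hl_apply f) 0 = 0"
  by (simp add: truncated_dilation_def T_zero homogeneous_part_at_0)

text \<open>Stated for differences of values so that it serves twice: as a Lipschitz estimate for the tail, and,
with \<open>y = 0\<close>, as an estimate of its size.\<close>

lemma q_close_dilation:
  assumes "norm x < 1" "norm y < 1"
  shows "cmod ((hl_apply f (r *\<^sub>R T x) - hl_apply f (r *\<^sub>R T y)) - (q (hl_apply f) x - q (hl_apply f) y))
    \<le> norm f * norm (T x - T y) * (1 - r)"
proof -
  have "norm (T x) < 1" "norm (T y) < 1" using assms T_le le_less_trans by blast+
  from homogeneous_expansion_remainder[OF hl_lipschitz hl_holomorphic this, of "of_real r" f n]
  have "cmod ((hl_apply f (r *\<^sub>R T x) - hl_apply f (r *\<^sub>R T y)) - (q (hl_apply f) x - q (hl_apply f) y))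
      \<le> norm f * norm (T x - T y) * (r ^ Suc n / (1 - r))"
    using r by (simp add: truncated_dilation_def scaleC_of_real right_diff_distrib sum_subtractf)
  also have "\<dots> \<le> norm f * norm (T x - T y) * (1 - r)"
    by (rule mult_left_mono[OF n]) simp
  finally show ?thesis .
qed

lemma q_lipschitz: "(norm f)-lipschitz_on (ball 0 1) (q (hl_apply f))"
proof (rule lipschitz_onI)
  fix x y :: 'a assume "x \<in> ball 0 1" "y \<in> ball 0 1"
  then have xy: "norm x < 1" "norm y < 1" by auto
  have small: "norm (r *\<^sub>R T z) < 1" if "norm z < 1" for z
    using T_le[of z] that r mult_left_le_one_le[of "norm (T z)" r] by simp
  have "cmod (hl_apply f (r *\<^sub>R T x) - hl_apply f (r *\<^sub>R T y)) \<le> norm f * norm (r *\<^sub>R T x - r *\<^sub>R T y)"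
    using lipschitz_onD[OF hl_lipschitz, of "r *\<^sub>R T x" "r *\<^sub>R T y" f] small xy by (simp add: dist_norm)
  also have "\<dots> = norm f * norm (T x - T y) * r"
    using r by (simp add: scaleR_diff_right[symmetric])
  finally have "cmod (q (hl_apply f) x - q (hl_apply f) y)
      \<le> norm f * norm (T x - T y) * r + norm f * norm (T x - T y) * (1 - r)"
    using q_close_dilation[OF xy, of f]
      norm_triangle_ineq4[of "hl_apply f (r *\<^sub>R T x) - hl_apply f (r *\<^sub>R T y)"
        "(hl_apply f (r *\<^sub>R T x) - hl_apply f (r *\<^sub>R T y)) - (q (hl_apply f) x - q (hl_apply f) y)"]
    by simp
  also have "\<dots> = norm f * norm (T (x - y))"
    by (simp add: algebra_simps complex_linear_diff[OF T_linear])
  also have "\<dots> \<le> norm f * norm (x - y)" by (intro mult_left_mono T_le) simp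
  finally show "dist (q (hl_apply f) x) (q (hl_apply f) y) \<le> norm f * dist x y"
    by (simp add: dist_norm)
qed simp

lemma q_holomorphic: "Gateaux_holomorphic (q (hl_apply f))"
  unfolding Gateaux_holomorphic_def truncated_dilation_def
proof (intro allI holomorphic_on_sum holomorphic_on_mult holomorphic_on_const)
  fix x y :: 'a and k
  have "T (x + c *\<^sub>C y) = T x + c *\<^sub>C T y" for c
    using T_linear by (simp add: complex_linear_def)
  then show "(\<lambda>c. homogeneous_part k (hl_apply f) (T (x + c *\<^sub>C y))) holomorphic_on line_domain x y"
    using holomorphic_on_subset[OF homogeneous_part_entire_on_lines[OF hl_lipschitz hl_holomorphic hl_zero]]
    by simp
qed

lemma Q_apply: "norm x < 1 \<Longrightarrow> hl_apply (Q f) x = q (hl_apply f) x"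
  and norm_Q: "norm (Q f) \<le> norm f"
  unfolding truncated_dilation_op_def using hol_lip_of[OF q_lipschitz q_holomorphic q_zero] by auto

lemma Q_linear: "complex_linear Q"
proof -
  have q_add: "q (hl_apply (f + g)) x = q (hl_apply f) x + q (hl_apply g) x"
    and q_scaleC: "q (hl_apply (c *\<^sub>C f)) x = c * q (hl_apply f) x" for f g :: "'a hol_lip" and c x
    unfolding truncated_dilation_def
    using homogeneous_part_hl_linear[unfolded complex_linear_def, THEN conjunct1, rule_format, of _ f g "T x"]
      homogeneous_part_hl_linear[unfolded complex_linear_def, THEN conjunct2, rule_format, of _ c f "T x"]
    by (simp_all add: distrib_left sum.distrib sum_distrib_left mult.left_commute)
  show ?thesis
    unfolding complex_linear_def
    by (intro conjI allI hl_eqI) (simp_all add: Q_apply hl_add hl_scaleC q_add q_scaleC)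
qed

lemma Q_close:
  assumes x: "norm x < 1"
  shows "cmod (hl_apply (Q f - f) x) \<le> norm f * (norm (T x - x) + 2 * (1 - r))"
proof -
  have Tx: "norm (T x) < 1" using x T_le le_less_trans by blast
  have 1: "cmod (q (hl_apply f) x - hl_apply f (r *\<^sub>R T x)) \<le> norm f * (1 - r)"
  proof -
    have "cmod (hl_apply f (r *\<^sub>R T x) - q (hl_apply f) x) \<le> norm f * norm (T x) * (1 - r)"
      using q_close_dilation[OF x, of 0 f] by (simp add: q_zero T_zero)
    also have "\<dots> \<le> norm f * 1 * (1 - r)"
      using Tx r by (intro mult_right_mono mult_left_mono) auto
    finally show ?thesis by (simp add: norm_minus_commute)
  qed
  have 2: "cmod (hl_apply f (r *\<^sub>R T x) - hl_apply f x) \<le> norm f * (norm (T x - x) + (1 - r))"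
  proof -
    have "norm (r *\<^sub>R T x) < 1"
      using Tx r mult_left_le_one_le[of "norm (T x)" r] by simp
    then have "cmod (hl_apply f (r *\<^sub>R T x) - hl_apply f x) \<le> norm f * norm (r *\<^sub>R T x - x)"
      using lipschitz_onD[OF hl_lipschitz, of "r *\<^sub>R T x" x f] x by (simp add: dist_norm)
    also have "r *\<^sub>R T x - x = (T x - x) - (1 - r) *\<^sub>R T x" by (simp add: algebra_simps)
    also have "norm \<dots> \<le> norm (T x - x) + norm ((1 - r) *\<^sub>R T x)" by (rule norm_triangle_ineq4)
    also have "norm ((1 - r) *\<^sub>R T x) \<le> 1 - r" using Tx r by (simp add: mult_left_le)
    finally show ?thesis by (simp add: mult_left_mono)
  qed
  have "hl_apply (Q f - f) x = (q (hl_apply f) x - hl_apply f (r *\<^sub>R T x)) + (hl_apply f (r *\<^sub>R T x) - hl_apply f x)"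
    using x by (simp add: hl_diff Q_apply)
  then have "cmod (hl_apply (Q f - f) x) \<le> norm f * (1 - r) + norm f * (norm (T x - x) + (1 - r))"
    using 1 2 by (metis norm_triangle_mono)
  then show ?thesis by (simp add: algebra_simps)
qed

text \<open>Cauchy's estimates on circles of radius \<open>1/2\<close> bound the finitely many homogeneous parts in \<open>Q f\<close>, at the
points \<open>T x\<close> with \<open>x\<close> in a compact set, by the values of \<open>f\<close> on a compact set. This is the continuity of
\<open>Q\<close> that lets it act on the predual by transposition.\<close>

lemma Q_small:
  assumes \<delta>: "0 < \<delta>" and K: "compact K" "K \<subseteq> ball 0 1"
  shows "\<exists>K' \<delta>'. compact K' \<and> K' \<subseteq> ball 0 1 \<and> 0 < \<delta>' \<and>
    (\<forall>f. (\<forall>y\<in>K'. cmod (hl_apply f y) < \<delta>') \<longrightarrow> (\<forall>x\<in>K. cmod (hl_apply (Q f) x) < \<delta>))"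
proof -
  define M where "M = (\<Sum>k\<le>n. 2 ^ k) + (1::real)"
  have M: "0 < M" by (simp add: M_def sum_nonneg add_nonneg_pos)
  let ?K' = "(\<lambda>(z, x). z *\<^sub>C T x) ` (sphere 0 (1/2) \<times> K)"
  have cK: "compact ?K'"
  proof (rule compact_continuous_image)
    show "continuous_on (sphere 0 (1 / 2) \<times> K) (\<lambda>(z, x). z *\<^sub>C T x)"
    proof -
      have "continuous_on UNIV T"
        using T_bounded by (simp add: bounded_clinear_def linear_continuous_on)
      from continuous_on_scaleC[OF continuous_on_fst[OF continuous_on_id]
          continuous_on_compose2[OF this continuous_on_snd[OF continuous_on_id] subset_UNIV]]
      show ?thesis unfolding case_prod_beta .
    qed
  qed (intro compact_Times K(1) compact_sphere)
  have Tlt: "norm (T x) < 1" if "x \<in> K" for x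
    using K(2) that T_le[of x] by (auto intro: le_less_trans)
  have sK: "?K' \<subseteq> ball 0 1"
  proof
    fix y assume "y \<in> ?K'"
    then obtain z x where z: "cmod z = 1 / 2" and x: "x \<in> K" and y: "y = z *\<^sub>C T x" by auto
    show "y \<in> ball 0 1" using Tlt[OF x] norm_ge_zero[of "T x"] unfolding y mem_ball_0 norm_scaleC z by linarith
  qed
  have "cmod (hl_apply (Q f) x) < \<delta>"
    if f: "\<forall>y\<in>?K'. cmod (hl_apply f y) < \<delta> / M" and x: "x \<in> K" for f :: "'a hol_lip" and x
  proof -
  have part: "cmod (of_real r ^ k * homogeneous_part k (hl_apply f) (T x)) \<le> \<delta> / M * 2 ^ k" for k
  proof -
    have "cmod (homogeneous_part k (hl_apply f) (T x)) \<le> (\<delta> / M) / (1/2) ^ k"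
    proof (rule homogeneous_part_bound[OF hl_holomorphic])
      show "cmod (hl_apply f (z *\<^sub>C T x)) \<le> \<delta> / M" if "cmod z = 1 / 2" for z
        using bspec[OF f, of "z *\<^sub>C T x"] that x by force
    qed (use Tlt[OF x] in auto)
    moreover have "cmod (of_real r ^ k) \<le> 1" using r by (simp add: norm_power power_le_one)
    ultimately have "cmod (of_real r ^ k) * cmod (homogeneous_part k (hl_apply f) (T x)) \<le> 1 * ((\<delta> / M) / (1/2) ^ k)"
      by (intro mult_mono) auto
    then show ?thesis by (simp add: norm_mult power_one_over field_simps)
  qed
  have "cmod (q (hl_apply f) x) \<le> (\<Sum>k\<le>n. \<delta> / M * 2 ^ k)"
    unfolding truncated_dilation_def by (rule sum_norm_le) (rule part)
  also have "\<dots> = \<delta> / M * (M - 1)" by (simp add: M_def sum_distrib_left)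
  also have "\<dots> < \<delta>" using \<delta> M by (simp add: field_simps)
  finally show "cmod (hl_apply (Q f) x) < \<delta>" using x K(2) by (auto simp: Q_apply)
  qed
  moreover have "0 < \<delta> / M" using \<delta> M by simp
  ultimately show ?thesis using cK sK by blast
qed

text \<open>The restriction of the transpose of \<open>Q\<close> to the predual.\<close>

definition Q_star :: "'a G0 \<Rightarrow> 'a G0"
  where "Q_star \<phi> = G0_of (\<lambda>f. blinfun_apply (G0_functional \<phi>) (Q f))"

lemma Q_star_apply: "blinfun_apply (G0_functional (Q_star \<phi>)) f = blinfun_apply (G0_functional \<phi>) (Q f)"
proof -
  let ?\<phi> = "blinfun_apply (G0_functional \<phi>)"
  have 1: "complex_linear (\<lambda>f. ?\<phi> (Q f))"
    using Q_linear G0_functional_linear[of \<phi>] by (simp add: complex_linear_def)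
  have 2: "cmod (?\<phi> (Q f)) \<le> norm \<phi> * norm f" for f
    using G0_functional_bound[of \<phi> "Q f"] mult_left_mono[OF norm_Q[of f], of "norm \<phi>"] by simp
  have 3: "small_on_compacts (\<lambda>f. ?\<phi> (Q f))"
    unfolding small_on_compacts_def
  proof (intro allI impI)
    fix \<epsilon> :: real assume \<epsilon>: "0 < \<epsilon>"
    obtain K \<delta> where K: "compact K" "K \<subseteq> ball 0 1" "0 < \<delta>"
      and le: "\<forall>f. norm f \<le> 1 \<longrightarrow> (\<forall>x\<in>K. cmod (hl_apply f x) < \<delta>) \<longrightarrow> cmod (?\<phi> f) < \<epsilon>"
      using G0_functional_small_on_compacts[of \<phi>, unfolded small_on_compacts_def, rule_format, OF \<epsilon>]
      by (elim exE conjE)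
    obtain K' \<delta>' where K': "compact K'" "K' \<subseteq> ball 0 1" "0 < \<delta>'"
      and Q: "\<forall>f. (\<forall>y\<in>K'. cmod (hl_apply f y) < \<delta>') \<longrightarrow> (\<forall>x\<in>K. cmod (hl_apply (Q f) x) < \<delta>)"
      using Q_small[OF K(3,1,2)] by (elim exE conjE)
    have "cmod (?\<phi> (Q f)) < \<epsilon>" if f: "norm f \<le> 1" "\<forall>x\<in>K'. cmod (hl_apply f x) < \<delta>'" for f
      using le[rule_format, of "Q f"] Q[rule_format, of f] f norm_Q[of f] by force
    then show "\<exists>K \<delta>. compact K \<and> K \<subseteq> ball 0 1 \<and> 0 < \<delta> \<and>
        (\<forall>f. norm f \<le> 1 \<longrightarrow> (\<forall>x\<in>K. cmod (hl_apply f x) < \<delta>) \<longrightarrow> cmod (?\<phi> (Q f)) < \<epsilon>)"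
      using K' by blast
  qed
  show ?thesis unfolding Q_star_def by (simp add: G0_of[OF 1 2 3])
qed

lemma Q_star_linear: "complex_linear Q_star"
  unfolding complex_linear_def by (intro conjI allI G0_eqI) (simp_all add: G0_arith Q_star_apply)

lemma norm_Q_star: "norm (Q_star \<phi>) \<le> norm \<phi>"
  using G0_functional_bound[of \<phi>] mult_left_mono[OF norm_Q, of "norm \<phi>"]
  by (intro norm_G0_le) (auto simp: Q_star_apply intro: order_trans)

lemma Q_star_bounded: "bounded_clinear Q_star"
  using norm_Q_star by (intro bounded_clinearI[OF Q_star_linear, of 1]) simp

lemma onorm_Q_star: "onorm Q_star \<le> 1"
  using norm_Q_star by (intro onorm_bound) auto

text \<open>If all homogeneous parts of \<open>f\<close> of degree at most \<open>n\<close> vanish on the grids for a finite spanning set of the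
range of \<open>T\<close>, then \<open>Q f = 0\<close>. So the functionals \<open>Q_star \<phi>\<close> lie in the span of the finitely many Taylor
functionals at these grid points.\<close>

lemma Q_star_finite_rank: "finite_rank Q_star"
proof -
  obtain B where B: "finite B" "range T \<subseteq> cvs.span B"
    using T_finite unfolding finite_rank_def by blast
  have "\<exists>G. finite G \<and> (\<forall>h. polynomial_on_lines k h \<longrightarrow> (\<forall>g\<in>G. h g = 0) \<longrightarrow> (\<forall>x\<in>cvs.span B. h x = 0))" for k
    by (rule polynomial_on_lines_determined_by_grid[OF B(1)])
  then obtain G where G: "\<And>k. finite (G k)"
    "\<And>k h x. polynomial_on_lines k h \<Longrightarrow> \<forall>g\<in>G k. h g = 0 \<Longrightarrow> x \<in> cvs.span B \<Longrightarrow> h x = 0"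
    by metis
  define I where "I = (SIGMA k:{..n}. G k)"
  have I: "finite I" unfolding I_def using G(1) by blast
  let ?v = "\<lambda>(k, g). taylor_functional k g"
  have "Q_star \<phi> \<in> cvs.span (?v ` I)" for \<phi>
  proof -
    have "\<exists>c. \<forall>f. blinfun_apply (G0_functional (Q_star \<phi>)) f = (\<Sum>i\<in>I. c i * blinfun_apply (G0_functional (?v i)) f)"
    proof (rule functional_in_span_of_functionals[OF I G0_functional_linear G0_functional_linear])
      fix f :: "'a hol_lip" assume v: "\<And>i. i \<in> I \<Longrightarrow> blinfun_apply (G0_functional (?v i)) f = 0"
      have zero: "homogeneous_part k (hl_apply f) (T x) = 0" if k: "k \<le> n" for k x
      proof (rule G(2)[OF homogeneous_part_polynomial_on_lines[OF hl_lipschitz hl_holomorphic hl_zero]])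
        show "\<forall>g\<in>G k. homogeneous_part k (hl_apply f) g = 0"
        proof
          fix g assume "g \<in> G k"
          then have "(k, g) \<in> I" using k by (simp add: I_def)
          from v[OF this] show "homogeneous_part k (hl_apply f) g = 0" by (simp add: taylor_functional_apply)
        qed
        show "T x \<in> cvs.span B" using B(2) by blast
      qed
      have "Q f = 0"
        by (rule hl_eqI) (simp add: Q_apply truncated_dilation_def zero zero_hol_lip.rep_eq)
      then show "blinfun_apply (G0_functional (Q_star \<phi>)) f = 0" by (simp add: Q_star_apply)
    qed
    then obtain c where c: "\<And>f. blinfun_apply (G0_functional (Q_star \<phi>)) f = (\<Sum>i\<in>I. c i * blinfun_apply (G0_functional (?v i)) f)"
      by blast
    have "Q_star \<phi> = (\<Sum>i\<in>I. c i *\<^sub>C ?v i)"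
      by (rule G0_eqI) (simp add: c G0_sum G0_arith)
    also have "\<dots> \<in> cvs.span (?v ` I)"
      by (intro cvs.span_sum cvs.span_scale cvs.span_base imageI)
    finally show ?thesis .
  qed
  then show ?thesis unfolding finite_rank_def using I by blast
qed

end

lemma ex_geometric_tail_le:
  assumes "0 < r" "r < (1::real)"
  shows "\<exists>n. r ^ Suc n / (1 - r) \<le> 1 - r"
proof -
  obtain n where "r ^ n < (1 - r) * (1 - r)"
    using real_arch_pow_inv[of "(1 - r) * (1 - r)" r] assms by auto
  then have "r ^ Suc n \<le> (1 - r) * (1 - r)"
    using power_decreasing[of n "Suc n" r] assms by linarith
  then show ?thesis using assms by (intro exI[of _ n]) (simp add: divide_le_eq)
qed

text \<open>The operators \<open>Q_star\<close> are contractions, so it suffices to approximate the members of a finite net.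
Each of these functionals is small at functions that are small on some compact set, and \<open>Q f - f\<close> is
small there, uniformly for \<open>L(f) \<le> 1\<close>, when \<open>T\<close> is close to the identity on that set and \<open>r\<close> is close to 1.\<close>

theorem MAP_imp_G0_MAP:
  assumes MAP: "metric_approximation_property TYPE('a::complex_banach)"
  shows "metric_approximation_property TYPE('a G0)"
  unfolding metric_approximation_property_def
proof (intro allI impI)
  fix \<K> :: "'a G0 set" and \<epsilon> :: real
  assume \<epsilon>: "0 < \<epsilon>" and "compact \<K>"
  then obtain N where N: "finite N" "\<K> \<subseteq> (\<Union>\<phi>\<in>N. ball \<phi> (\<epsilon> / 4))"
    unfolding compact_eq_totally_bounded by (meson zero_less_divide_iff zero_less_numeral)
  define small_on where "small_on \<phi> K \<delta> \<longleftrightarrow> compact K \<and> K \<subseteq> ball 0 1 \<and> 0 < \<delta> \<and> (\<forall>f. norm f \<le> 1 \<longrightarrow>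
      (\<forall>x\<in>K. cmod (hl_apply f x) < \<delta>) \<longrightarrow> cmod (blinfun_apply (G0_functional \<phi>) f) < \<epsilon> / 8)"
    for \<phi> :: "'a G0" and K \<delta>
  have "\<exists>K \<delta>. small_on \<phi> K \<delta>" for \<phi>
    unfolding small_on_def
    by (rule G0_functional_small_on_compacts[of \<phi>, unfolded small_on_compacts_def, rule_format])
      (use \<epsilon> in simp)
  then obtain K \<delta> where small_on: "\<And>\<phi>. small_on \<phi> (K \<phi>) (\<delta> \<phi>)" by metis
  have K: "\<And>\<phi>. compact (K \<phi>)" "\<And>\<phi>. K \<phi> \<subseteq> ball 0 1" "\<And>\<phi>. 0 < \<delta> \<phi>"
    and small: "\<And>\<phi> f. norm f \<le> 1 \<Longrightarrow> \<forall>x\<in>K \<phi>. cmod (hl_apply f x) < \<delta> \<phi> \<Longrightarrow>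
      cmod (blinfun_apply (G0_functional \<phi>) f) < \<epsilon> / 8"
    using small_on unfolding small_on_def by simp_all
  define \<eta> where "\<eta> = Min (insert 1 (\<delta> ` N))"
  have \<eta>: "0 < \<eta>" "\<And>\<phi>. \<phi> \<in> N \<Longrightarrow> \<eta> \<le> \<delta> \<phi>" "\<eta> \<le> 1" using N(1) K(3) by (auto simp: \<eta>_def)
  have "compact (\<Union>\<phi>\<in>N. K \<phi>)" using N(1) K(1) by blast
  then obtain T :: "'a \<Rightarrow> 'a" where T: "bounded_clinear T" "finite_rank T" "onorm T \<le> 1"
    and close: "\<And>x. x \<in> (\<Union>\<phi>\<in>N. K \<phi>) \<Longrightarrow> norm (T x - x) < \<eta>"
    using MAP \<eta>(1) unfolding metric_approximation_property_def by meson
  \<comment> \<open>With this choice the error \<open>norm (T x - x) + 2 * (1 - r)\<close> stays below \<open>2 * \<eta>\<close>.\<close>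
  define r where "r = 1 - \<eta> / 4"
  have r: "0 < r" "r < 1" using \<eta> by (auto simp: r_def)
  obtain n where n: "r ^ Suc n / (1 - r) \<le> 1 - r" using ex_geometric_tail_le[OF r] by blast
  interpret finite_rank_dilation T r n
    using T r n by unfold_locales
  have net: "norm (Q_star \<phi> - \<phi>) \<le> \<epsilon> / 4" if \<phi>: "\<phi> \<in> N" for \<phi>
  proof (rule norm_G0_le_unit_ball)
    fix f :: "'a hol_lip" assume f: "norm f \<le> 1"
    let ?h = "(1/2) *\<^sub>C (Q f - f)"
    have "cmod (blinfun_apply (G0_functional \<phi>) ?h) < \<epsilon> / 8"
    proof (rule small)
      show "norm ?h \<le> 1" using f norm_Q[of f] norm_triangle_ineq4[of "Q f" f] by (simp add: norm_scaleC)
      show "\<forall>x\<in>K \<phi>. cmod (hl_apply ?h x) < \<delta> \<phi>"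
      proof
        fix x assume x: "x \<in> K \<phi>"
        then have "norm x < 1" using K(2)[of \<phi>] by auto
        then have "cmod (hl_apply (Q f - f) x) \<le> norm f * (norm (T x - x) + 2 * (1 - r))" by (rule Q_close)
        also have "\<dots> \<le> 1 * (norm (T x - x) + 2 * (1 - r))" using f r by (intro mult_right_mono) auto
        also have "\<dots> < 2 * \<eta>"
        proof -
          have "norm (T x - x) < \<eta>" using x \<phi> by (intro close) blast
          then show ?thesis using \<eta>(1) by (simp add: r_def)
        qed
        finally show "cmod (hl_apply ?h x) < \<delta> \<phi>" using \<eta>(2)[OF \<phi>] by (simp add: hl_scaleC norm_divide)
      qed
    qed
    moreover have "blinfun_apply (G0_functional \<phi>) ?h = blinfun_apply (G0_functional (Q_star \<phi> - \<phi>)) f / 2"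
      using G0_functional_linear[of \<phi>] complex_linear_diff[OF G0_functional_linear[of \<phi>], of "Q f" f]
      unfolding complex_linear_def by (simp add: G0_arith Q_star_apply)
    ultimately show "cmod (blinfun_apply (G0_functional (Q_star \<phi> - \<phi>)) f) \<le> \<epsilon> / 4"
      by (simp add: norm_divide)
  qed (use \<epsilon> in simp)
  have "norm (Q_star \<phi> - \<phi>) < \<epsilon>" if "\<phi> \<in> \<K>" for \<phi>
  proof -
    obtain \<psi> where \<psi>: "\<psi> \<in> N" "norm (\<psi> - \<phi>) < \<epsilon> / 4" using N(2) \<open>\<phi> \<in> \<K>\<close> by (auto simp: dist_norm)
    have "Q_star \<phi> - \<phi> = Q_star (\<phi> - \<psi>) + ((Q_star \<psi> - \<psi>) + (\<psi> - \<phi>))"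
      by (simp add: complex_linear_diff[OF Q_star_linear])
    also have "norm \<dots> \<le> norm (Q_star (\<phi> - \<psi>)) + (norm (Q_star \<psi> - \<psi>) + norm (\<psi> - \<phi>))"
      by (intro norm_triangle_le add_left_mono norm_triangle_ineq)
    also have "\<dots> < \<epsilon> / 4 + (\<epsilon> / 4 + \<epsilon> / 4)"
      using net[OF \<psi>(1)] \<psi>(2) norm_Q_star[of "\<phi> - \<psi>"] by (simp add: norm_minus_commute)
    finally show ?thesis using \<epsilon> by simp
  qed
  then show "\<exists>T. bounded_clinear T \<and> finite_rank T \<and> onorm T \<le> 1 \<and> (\<forall>x\<in>\<K>. norm (T x - x) < \<epsilon>)"
    using Q_star_bounded Q_star_finite_rank onorm_Q_star by blast
qed

section \<open>Barycentres and the way back to the space\<close>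

lemma hl_scaleR: "hl_apply (r *\<^sub>R f) x = of_real r * hl_apply f x"
  unfolding scaleC_of_real[symmetric] by (rule hl_scaleC)

text \<open>Combinations of evaluations at points are dense in the predual. On the functions that vanish on a
fine enough finite net \<open>A\<close> of the compact set belonging to \<open>\<phi>\<close> and \<open>\<epsilon>\<close>, the functional \<open>\<phi>\<close> has norm at most
\<open>\<epsilon>\<close>. A Hahn-Banach extension \<open>F\<close> of this restriction has the same bound, and \<open>\<phi> - F\<close> vanishes on the
common kernel of the evaluations at \<open>A\<close>, hence is a combination of them.\<close>

lemma G0_approximable_by_evaluations:
  fixes \<phi> :: "'a::complex_normed_vector G0"
  assumes \<epsilon>: "0 < \<epsilon>"
  shows "\<exists>A c. finite A \<and> A \<subseteq> ball 0 1 \<and>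
    (\<forall>f. cmod (blinfun_apply (G0_functional \<phi>) f - (\<Sum>x\<in>A. c x * hl_apply f x)) \<le> \<epsilon> * norm f)"
proof -
  let ?\<phi> = "blinfun_apply (G0_functional \<phi>)"
  obtain K \<delta> where K: "compact K" "K \<subseteq> ball 0 1" "0 < \<delta>"
    and le: "\<forall>f. norm f \<le> 1 \<longrightarrow> (\<forall>x\<in>K. cmod (hl_apply f x) < \<delta>) \<longrightarrow> cmod (?\<phi> f) < \<epsilon>"
    using G0_functional_small_on_compacts[of \<phi>, unfolded small_on_compacts_def, rule_format, OF \<epsilon>]
    by (elim exE conjE)
  obtain A where A: "finite A" "A \<subseteq> K" "K \<subseteq> (\<Union>x\<in>A. ball x \<delta>)"
    using seq_compact_imp_totally_bounded[of K] K(1,3) unfolding compact_eq_seq_compact_metric by meson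
  define N where "N = {f :: 'a hol_lip. \<forall>x\<in>A. hl_apply f x = 0}"
  have bound: "cmod (?\<phi> f) \<le> \<epsilon> * norm f" if f: "f \<in> N" for f
  proof (cases "f = 0")
    case False
    define g where "g = inverse (norm f) *\<^sub>R f"
    have g: "norm g = 1" using False by (simp add: g_def)
    have "cmod (?\<phi> g) < \<epsilon>"
    proof (rule le[rule_format])
      fix y assume y: "y \<in> K"
      then obtain x where x: "x \<in> A" "dist x y < \<delta>" using A(3) by auto
      have "hl_apply g x = 0" using f x(1) by (simp add: g_def hl_scaleR N_def)
      moreover have "dist (hl_apply g y) (hl_apply g x) \<le> norm g * dist y x"
        using x(1) y A(2) K(2) by (intro lipschitz_onD[OF hl_lipschitz]) auto
      ultimately show "cmod (hl_apply g y) < \<delta>" using x(2) g by (simp add: dist_commute)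
    qed (use g in simp)
    then show ?thesis using False by (simp add: g_def blinfun.scaleR_right divide_simps mult.commute)
  qed simp
  obtain F where F: "complex_linear F" "\<And>f. cmod (F f) \<le> \<epsilon> * norm f" "\<And>f. f \<in> N \<Longrightarrow> F f = ?\<phi> f"
  proof (rule Hahn_Banach_complex[OF _ _ _ G0_functional_linear bound])
    show "0 \<in> N" "\<And>x y. x \<in> N \<Longrightarrow> y \<in> N \<Longrightarrow> x + y \<in> N" "\<And>c x. x \<in> N \<Longrightarrow> c *\<^sub>C x \<in> N"
      by (auto simp: N_def hl_add hl_scaleC zero_hol_lip.rep_eq)
  qed (use \<epsilon> in auto)
  have "\<exists>c. \<forall>f. ?\<phi> f - F f = (\<Sum>x\<in>A. c x * hl_apply f x)"
  proof (rule functional_in_span_of_functionals[OF A(1) complex_linear_evaluation])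
    show "complex_linear (\<lambda>f. ?\<phi> f - F f)"
      using G0_functional_linear[of \<phi>] F(1) unfolding complex_linear_def by (simp add: algebra_simps)
    show "?\<phi> f - F f = 0" if "\<And>x. x \<in> A \<Longrightarrow> hl_apply f x = 0" for f
      using F(3)[of f] that by (simp add: N_def)
  qed
  then obtain c where c: "\<And>f. ?\<phi> f - F f = (\<Sum>x\<in>A. c x * hl_apply f x)" by blast
  have "cmod (?\<phi> f - (\<Sum>x\<in>A. c x * hl_apply f x)) \<le> \<epsilon> * norm f" for f
    using F(2)[of f] by (simp add: c[symmetric])
  then show ?thesis using A(1,2) K(2) by (intro exI[of _ A] exI[of _ c]) auto
qed

definition contractive_functional :: "('a::complex_normed_vector \<Rightarrow> complex) \<Rightarrow> bool"
  where "contractive_functional F \<longleftrightarrow> complex_linear F \<and> (\<forall>y. cmod (F y) \<le> norm y)"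

lemma contractive_functional_norming:
  fixes x :: "'a::complex_normed_vector"
  obtains F where "contractive_functional F" "norm x \<le> cmod (F x)"
  using norming_functional[of x] unfolding contractive_functional_def by blast

lemma contractive_functional_diff: "contractive_functional F \<Longrightarrow> F (x - y) = F x - F y"
  unfolding contractive_functional_def by (blast intro: complex_linear_diff)

lemma contractive_functional_sum:
  assumes "contractive_functional F"
  shows "F (\<Sum>i\<in>I. c i *\<^sub>C x i) = (\<Sum>i\<in>I. c i * F (x i))"
proof -
  have "F 0 = 0" using contractive_functional_diff[OF assms, of 0 0] by simp
  then show ?thesis
    using assms by (induction I rule: infinite_finite_induct)
      (simp_all add: contractive_functional_def complex_linear_def)
qed

text \<open>The restriction of \<open>\<phi>\<close> to linear functionals on the space is an element of the bidual; a barycentre is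
a point of the space itself that represents it.\<close>

definition is_barycentre :: "'a::complex_normed_vector G0 \<Rightarrow> 'a \<Rightarrow> bool"
  where "is_barycentre \<phi> x \<longleftrightarrow>
    (\<forall>F. contractive_functional F \<longrightarrow> F x = blinfun_apply (G0_functional \<phi>) (hol_lip_of F))"

lemma norm_hol_lip_of_functional: "contractive_functional F \<Longrightarrow> norm (hol_lip_of F) \<le> 1"
  unfolding contractive_functional_def using hol_lip_of_functional(2) by blast

lemma hl_hol_lip_of_functional:
  "contractive_functional F \<Longrightarrow> norm x < 1 \<Longrightarrow> hl_apply (hol_lip_of F) x = F x"
  unfolding contractive_functional_def using hol_lip_of_functional(1) by blast

text \<open>A combination \<open>\<Sum>x. c x \<delta>\<^sub>x\<close> of evaluations has the barycentre \<open>\<Sum>x. c x x\<close>. Norming functionals show that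
approximations to \<open>\<phi>\<close> by such combinations have barycentres that form a Cauchy sequence, and
completeness supplies the limit.\<close>

theorem ex_barycentre:
  fixes \<phi> :: "'a::complex_banach G0"
  shows "\<exists>x. is_barycentre \<phi> x"
proof -
  let ?\<phi> = "blinfun_apply (G0_functional \<phi>)"
  have "\<exists>x. \<forall>F. contractive_functional F \<longrightarrow> cmod (?\<phi> (hol_lip_of F) - F x) \<le> inverse (real (Suc n))" for n
  proof -
    have pos: "0 < inverse (real (Suc n))" by simp
    obtain A c where A: "A \<subseteq> ball 0 1"
      and le: "\<And>f. cmod (?\<phi> f - (\<Sum>x\<in>A. c x * hl_apply f x)) \<le> inverse (real (Suc n)) * norm f"
      using G0_approximable_by_evaluations[OF pos, of \<phi>] by auto
    have "cmod (?\<phi> (hol_lip_of F) - F (\<Sum>x\<in>A. c x *\<^sub>C x)) \<le> inverse (real (Suc n))"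
      if F: "contractive_functional F" for F
    proof -
      have "(\<Sum>x\<in>A. c x * hl_apply (hol_lip_of F) x) = F (\<Sum>x\<in>A. c x *\<^sub>C x)"
        unfolding contractive_functional_sum[OF F]
        using A by (intro sum.cong) (auto simp: hl_hol_lip_of_functional[OF F])
      moreover have "inverse (real (Suc n)) * norm (hol_lip_of F) \<le> inverse (real (Suc n)) * 1"
        by (intro mult_left_mono norm_hol_lip_of_functional[OF F]) simp
      ultimately show ?thesis using le[of "hol_lip_of F"] by (simp only: mult_1_right order_trans)
    qed
    then show ?thesis by blast
  qed
  then obtain X where X: "\<And>n F. contractive_functional F \<Longrightarrow>
      cmod (?\<phi> (hol_lip_of F) - F (X n)) \<le> inverse (real (Suc n))"
    by metis
  have dist: "dist (X m) (X n) \<le> inverse (real (Suc m)) + inverse (real (Suc n))" for m n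
  proof -
    obtain F where F: "contractive_functional F" "norm (X m - X n) \<le> cmod (F (X m - X n))"
      by (rule contractive_functional_norming)
    have "F (X m - X n) = (?\<phi> (hol_lip_of F) - F (X n)) - (?\<phi> (hol_lip_of F) - F (X m))"
      by (simp add: contractive_functional_diff[OF F(1)])
    then show ?thesis
      using F(2) X[OF F(1), of m] X[OF F(1), of n] norm_triangle_ineq4[of "?\<phi> (hol_lip_of F) - F (X n)" "?\<phi> (hol_lip_of F) - F (X m)"]
      by (simp add: dist_norm)
  qed
  have "Cauchy X"
  proof (rule metric_CauchyI)
    fix e :: real assume e: "0 < e"
    then obtain M where M: "inverse (real (Suc M)) < e / 2"
      using reals_Archimedean[of "e / 2"] by auto
    have "dist (X m) (X n) < e" if "M \<le> m" "M \<le> n" for m n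
    proof -
      have "inverse (real (Suc m)) \<le> inverse (real (Suc M))" "inverse (real (Suc n)) \<le> inverse (real (Suc M))"
        using that by (auto intro!: le_imp_inverse_le)
      then show ?thesis using dist[of m n] M by linarith
    qed
    then show "\<exists>M. \<forall>m\<ge>M. \<forall>n\<ge>M. dist (X m) (X n) < e" by blast
  qed
  then obtain x where x: "X \<longlonglongrightarrow> x" using Cauchy_convergent_iff convergent_def by blast
  have "F x = ?\<phi> (hol_lip_of F)" if F: "contractive_functional F" for F
  proof -
    have 0: "(\<lambda>n. inverse (real (Suc n))) \<longlonglongrightarrow> 0" by (rule LIMSEQ_inverse_real_of_nat)
    have "(\<lambda>n. F (X n) - F x) \<longlonglongrightarrow> 0"
    proof (rule Lim_null_comparison)
      show "\<forall>\<^sub>F n in sequentially. norm (F (X n) - F x) \<le> norm (X n - x)"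
        unfolding contractive_functional_diff[OF F, symmetric]
        using F by (intro always_eventually) (simp add: contractive_functional_def)
      show "(\<lambda>n. norm (X n - x)) \<longlonglongrightarrow> 0" using x by (simp add: LIM_zero tendsto_norm_zero)
    qed
    then have 1: "(\<lambda>n. F (X n)) \<longlonglongrightarrow> F x" by (rule LIM_zero_cancel)
    have "(\<lambda>n. ?\<phi> (hol_lip_of F) - F (X n)) \<longlonglongrightarrow> 0"
      by (rule Lim_null_comparison[OF always_eventually 0]) (intro allI X[OF F])
    then have "(\<lambda>n. ?\<phi> (hol_lip_of F) - (?\<phi> (hol_lip_of F) - F (X n))) \<longlonglongrightarrow> ?\<phi> (hol_lip_of F) - 0"
      by (intro tendsto_diff tendsto_const)
    then have "(\<lambda>n. F (X n)) \<longlonglongrightarrow> ?\<phi> (hol_lip_of F)" by simp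
    with 1 show ?thesis by (rule LIMSEQ_unique)
  qed
  then show ?thesis unfolding is_barycentre_def by blast
qed

definition barycentre :: "'a::complex_banach G0 \<Rightarrow> 'a"
  where "barycentre \<phi> = (SOME x. is_barycentre \<phi> x)"

lemma barycentre_apply:
  "contractive_functional F \<Longrightarrow> F (barycentre \<phi>) = blinfun_apply (G0_functional \<phi>) (hol_lip_of F)"
  using someI_ex[OF ex_barycentre[of \<phi>], folded barycentre_def] unfolding is_barycentre_def by blast

lemma eq_if_functionals_agree:
  fixes x y :: "'a::complex_normed_vector"
  assumes "\<And>F. contractive_functional F \<Longrightarrow> F x = F y"
  shows "x = y"
proof -
  obtain F where F: "contractive_functional F" "norm (x - y) \<le> cmod (F (x - y))"
    by (rule contractive_functional_norming)
  then show ?thesis using assms[OF F(1)] contractive_functional_diff[OF F(1), of x y] by simp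
qed

lemma barycentre_linear: "complex_linear barycentre"
  unfolding complex_linear_def
proof (intro conjI allI; rule eq_if_functionals_agree)
  fix \<phi> \<psi> :: "'a G0" and c and F :: "'a \<Rightarrow> complex"
  assume F: "contractive_functional F"
  then have lin: "F (x + y) = F x + F y" "F (c *\<^sub>C x) = c * F x" for x y c
    by (auto simp: contractive_functional_def complex_linear_def)
  show "F (barycentre (\<phi> + \<psi>)) = F (barycentre \<phi> + barycentre \<psi>)"
    by (simp add: lin barycentre_apply[OF F] plus_G0.rep_eq blinfun.add_left)
  show "F (barycentre (c *\<^sub>C \<phi>)) = F (c *\<^sub>C barycentre \<phi>)"
    by (simp add: lin barycentre_apply[OF F] scaleC_G0.rep_eq scaleC_blinfun.rep_eq)
qed

lemma norm_barycentre: "norm (barycentre \<phi>) \<le> norm \<phi>"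
proof -
  obtain F where F: "contractive_functional F" "norm (barycentre \<phi>) \<le> cmod (F (barycentre \<phi>))"
    by (rule contractive_functional_norming)
  note F(2)
  also have "cmod (F (barycentre \<phi>)) \<le> norm \<phi> * norm (hol_lip_of F)"
    unfolding barycentre_apply[OF F(1)] by (rule G0_functional_bound)
  also have "\<dots> \<le> norm \<phi> * 1"
    by (intro mult_left_mono norm_hol_lip_of_functional F(1)) simp
  finally show ?thesis by simp
qed

text \<open>The derivative at the origin of a linear functional is the functional itself. Together with the
norm bounds on both maps this makes the space a contractively complemented subspace of the predual
of the holomorphic Lipschitz functions on its ball.\<close>

lemma barycentre_taylor_functional: "barycentre (taylor_functional 1 x) = x"
proof (rule eq_if_functionals_agree)
  fix F :: "'a \<Rightarrow> complex" assume F: "contractive_functional F"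
  have "((\<lambda>c. c * F x) has_field_derivative F x) (at 0)"
    by (auto intro!: derivative_eq_intros)
  then have "((\<lambda>c. hl_apply (hol_lip_of F) (0 + c *\<^sub>C x)) has_field_derivative F x) (at 0)"
  proof (rule has_field_derivative_transform_within_open[OF _ open_line_domain zero_in_line_domain])
    fix c assume "c \<in> line_domain 0 x"
    then show "c * F x = hl_apply (hol_lip_of F) (0 + c *\<^sub>C x)"
      using F by (simp add: line_domain_def hl_hol_lip_of_functional[OF F] contractive_functional_def complex_linear_def)
  qed simp
  then have "line_deriv (hl_apply (hol_lip_of F)) 0 x = F x"
    unfolding line_deriv_def by (rule DERIV_imp_deriv)
  then show "F (barycentre (taylor_functional 1 x)) = F x"
    unfolding barycentre_apply[OF F] taylor_functional_apply homogeneous_part_1_eq_line_deriv .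
qed

lemma taylor_functional_1_linear: "complex_linear (taylor_functional 1)"
  unfolding complex_linear_def
proof (intro conjI allI; rule G0_eqI)
  fix x y :: 'a and c and f :: "'a hol_lip"
  show "blinfun_apply (G0_functional (taylor_functional 1 (x + y))) f
      = blinfun_apply (G0_functional (taylor_functional 1 x + taylor_functional 1 y)) f"
    unfolding plus_G0.rep_eq blinfun.add_left taylor_functional_apply homogeneous_part_1_eq_line_deriv
    by (rule line_deriv_add[OF hl_lipschitz hl_holomorphic]) simp
  show "blinfun_apply (G0_functional (taylor_functional 1 (c *\<^sub>C x))) f
      = blinfun_apply (G0_functional (c *\<^sub>C taylor_functional 1 x)) f"
    unfolding scaleC_G0.rep_eq scaleC_blinfun.rep_eq taylor_functional_apply
    using homogeneous_part_scaleC[OF hl_holomorphic, of 1 f c x] by simp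
qed

lemma norm_taylor_functional_1: "norm (taylor_functional 1 x) \<le> norm x"
proof (rule norm_G0_le)
  fix f :: "'a hol_lip"
  define R where "R = 1 / (norm x + 1)"
  have R: "0 < R" "R * norm x < 1" by (auto simp: R_def add_nonneg_pos divide_simps)
  have "cmod (homogeneous_part 1 (hl_apply f) x) \<le> (norm f * (R * norm x)) / R ^ 1"
  proof (rule homogeneous_part_bound[OF hl_holomorphic R])
    show "cmod (hl_apply f (z *\<^sub>C x)) \<le> norm f * (R * norm x)" if "cmod z = R" for z
      using hl_bound[of "z *\<^sub>C x" f] R that by (simp add: norm_scaleC)
  qed
  then show "cmod (blinfun_apply (G0_functional (taylor_functional 1 x)) f) \<le> norm x * norm f"
    using R by (simp add: taylor_functional_apply mult.commute)
qed simp

text \<open>The metric approximation property passes to contractively complemented subspaces: an approximation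
\<open>T\<close> on the predual is compressed to the space by the embedding \<open>S\<close> and the barycentre map \<open>P\<close>.\<close>

theorem G0_MAP_imp_MAP:
  assumes MAP: "metric_approximation_property TYPE('a::complex_banach G0)"
  shows "metric_approximation_property TYPE('a)"
  unfolding metric_approximation_property_def
proof (intro allI impI)
  fix K :: "'a set" and \<epsilon> :: real
  assume \<epsilon>: "0 < \<epsilon>" and K: "compact K"
  let ?S = "taylor_functional 1 :: 'a \<Rightarrow> 'a G0"
  let ?P = "barycentre :: 'a G0 \<Rightarrow> 'a"
  have S: "bounded_clinear ?S"
    using norm_taylor_functional_1 by (intro bounded_clinearI[OF taylor_functional_1_linear, of 1]) simp
  have "compact (?S ` K)"
    using S K by (intro compact_continuous_image) (auto simp: bounded_clinear_def linear_continuous_on)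
  then obtain T where T: "bounded_clinear T" "finite_rank T" "onorm T \<le> 1"
    and close: "\<And>\<phi>. \<phi> \<in> ?S ` K \<Longrightarrow> norm (T \<phi> - \<phi>) < \<epsilon>"
    using MAP \<epsilon> unfolding metric_approximation_property_def by meson
  define U where "U x = ?P (T (?S x))" for x
  have lin: "complex_linear U"
    using barycentre_linear bounded_clinearD[OF T(1)] taylor_functional_1_linear
    unfolding U_def complex_linear_def by metis
  have le: "norm (U x) \<le> norm x" for x
  proof -
    have "norm (U x) \<le> norm (T (?S x))" unfolding U_def by (rule norm_barycentre)
    also have "\<dots> \<le> 1 * norm (?S x)"
      using onorm[of T "?S x"] T(1,3) mult_right_mono[of "onorm T" 1 "norm (?S x)"]
      by (simp add: bounded_clinear_def)
    also have "\<dots> \<le> norm x" using norm_taylor_functional_1 by simp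
    finally show ?thesis .
  qed
  have "bounded_clinear U" using le by (intro bounded_clinearI[OF lin, of 1]) simp
  moreover have "onorm U \<le> 1" using le by (intro onorm_bound) auto
  moreover have "finite_rank U"
  proof -
    obtain B where B: "finite B" "range T \<subseteq> cvs.span B" using T(2) unfolding finite_rank_def by blast
    have P: "Vector_Spaces.linear scaleC scaleC ?P"
      using barycentre_linear unfolding complex_linear_def
      by (intro Vector_Spaces.linear.intro scaleC_vector_space module_hom.intro module_hom_axioms.intro cvs.module_axioms) auto
    have "?P ` cvs.span B = cvs.span (?P ` B)"
      using Vector_Spaces.linear.axioms module_hom.span_image P by blast
    then have "range U \<subseteq> cvs.span (?P ` B)" using B(2) unfolding U_def by blast
    then show ?thesis unfolding finite_rank_def using B(1) by blast
  qed
  moreover have "norm (U x - x) < \<epsilon>" if "x \<in> K" for x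
  proof -
    have "U x - x = ?P (T (?S x) - ?S x)"
      by (simp add: U_def complex_linear_diff[OF barycentre_linear] barycentre_taylor_functional[unfolded One_nat_def])
    then show ?thesis using norm_barycentre[of "T (?S x) - ?S x"] close[of "?S x"] that by simp
  qed
  ultimately show "\<exists>T. bounded_clinear T \<and> finite_rank T \<and> onorm T \<le> 1 \<and> (\<forall>x\<in>K. norm (T x - x) < \<epsilon>)"
    by blast
qed

theorem theorem3p2:
  shows "metric_approximation_property TYPE('a::complex_banach) \<longleftrightarrow>
    metric_approximation_property TYPE('a G0)"
  using MAP_imp_G0_MAP G0_MAP_imp_MAP by blast

end
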